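(* There is an absolute constant $C>0$ such that for every finite set $S$ of arms, every $\epsilon\in(0,1)$ and every $\delta\in(0,1/2]$ there is an algorithm which, with probability at least $1-\delta$, outputs an arm $a\in S$ with $|\theta_a-\max_{i\in S}\theta_i|\le\epsilon$ and uses at most $$C\sum_{i\in S}\Big(\frac{\sigma_i^2}{\epsilon^2}+\frac{1}{\epsilon}\Big)\big(\ln\delta^{-1}+\mathrm{LL}(\epsilon^{-1})\big)$$ samples.
   Context: Bandit model: each arm $i$, when sampled, yields an independent draw from an unknown distribution supported on $[0,1]$ with mean $\theta_i$ and variance $\sigma_i^2$. An algorithm adaptively chooses (possibly randomly) which arm of $S$ to sample based on past observations, stops and outputs an arm; the number of samples is the total number of draws. For $x\ge1$, $\mathrm{LL}(x):=\ln(e+\ln x)$. *)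

theory Defs
  imports "HOL-Probability.Probability"
begin

text \<open>Arms are natural numbers.  An algorithm (policy) receives an internal random
seed u (uniform on [0,1], which encodes arbitrary independent randomness) and the
history of (arm, observation) pairs so far, and decides either to sample an arm
or to stop and output an arm.\<close>

datatype 'a action = Pull 'a | Stop 'a

type_synonym policy = "real \<Rightarrow> (nat \<times> real) list \<Rightarrow> nat action"

text \<open>Reward-table model: X i n is the n-th sample drawn from arm i.
hist P u X t is the history after t rounds of interaction.\<close>

fun hist :: "policy \<Rightarrow> real \<Rightarrow> (nat \<Rightarrow> nat \<Rightarrow> real) \<Rightarrow> nat \<Rightarrow> (nat \<times> real) list" where
  "hist P u X 0 = []"
| "hist P u X (Suc t) =
     (let h = hist P u X t in
      case P u h of
        Pull i \<Rightarrow> h @ [(i, X i (length (filter (\<lambda>p. fst p = i) h)))]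
      | Stop a \<Rightarrow> h)"

definition bandit_space :: "nat set \<Rightarrow> (nat \<Rightarrow> real measure) \<Rightarrow> (real \<times> (nat \<Rightarrow> nat \<Rightarrow> real)) measure" where
  "bandit_space S D =
     uniform_measure lborel {0..1} \<Otimes>\<^sub>M (\<Pi>\<^sub>M i\<in>S. \<Pi>\<^sub>M n\<in>(UNIV::nat set). D i)"

definition mean_of :: "real measure \<Rightarrow> real" where
  "mean_of M = (\<integral>x. x \<partial>M)"

definition var_of :: "real measure \<Rightarrow> real" where
  "var_of M = (\<integral>x. (x - mean_of M)\<^sup>2 \<partial>M)"

definition LL :: "real \<Rightarrow> real" where
  "LL x = ln (exp 1 + ln x)"

definition good_run :: "policy \<Rightarrow> nat set \<Rightarrow> (nat \<Rightarrow> real measure) \<Rightarrow> real \<Rightarrow> real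
    \<Rightarrow> real \<Rightarrow> (nat \<Rightarrow> nat \<Rightarrow> real) \<Rightarrow> bool" where
  "good_run P S D eps N u X \<longleftrightarrow>
     (\<exists>t a. P u (hist P u X t) = Stop a \<and> a \<in> S \<and>
        \<bar>mean_of (D a) - Max ((\<lambda>i. mean_of (D i)) ` S)\<bar> \<le> eps \<and>
        real (length (hist P u X t)) \<le> N)"

end

theory Submission
  imports Defs
begin

text \<open>
  Estimate every variance from \<open>L / eps\<close> samples, where \<open>L\<close> is of order \<open>ln (1 / delta) + LL (1 / eps)\<close>, and
  group the arms by the dyadic size \<open>2 ^ k * eps\<close> of the estimate. There are only \<open>K = O(ln (1 / eps))\<close> groups,
  so a union bound over them costs the factor \<open>LL (1 / eps)\<close>. Within a group all arms have the same price per
  unit of accuracy, and median elimination with geometrically decreasing accuracies \<open>epsr r\<close> reduces the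
  group to one arm at a cost linear in its size. The survivors are compared by a last score.

  An arm whose variance was badly underestimated must not win by noise. Therefore each score averages
  \<open>x - lam k * (x - y)\<^sup>2 / 2\<close> over independent pairs \<open>(x, y)\<close>, which has mean \<open>mean - lam k * variance\<close>. The penalty
  pays for the variance term in the exponential moment, so the score of no arm is too high, and since
  every mean is at most that of the best arm, an arm whose penalized mean is almost optimal has small variance.

  The samples used for a given group and round have indices that depend only on the group and the
  round, so they are independent of all the choices made before that round.
\<close>

subsection \<open>Policies that serve demands in stages\<close>

text \<open>The obstacle is \<open>ln (card S)\<close>: the sample bound has no such factor, so no
  step may require an event for every arm at once. Of the variance estimates only two facts are
  used: the estimate of one fixed optimal arm is not much too small, and the sum of all estimates is
  not much too large. The first says that the optimal arm loses little through the penalty of its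
  group, the second bounds the cost; all other arms may be misplaced. Likewise a round requires only
  that the best arm of the group scores well and that fewer than half of the group are poor arms
  scoring high, which is Markov's inequality for their number. The last comparison sees at most one
  arm per group. Union bounds therefore run over groups and rounds only, and the rounds contribute a
  geometric series because round \<open>r\<close> fails with probability of order
  \<open>exp (- (L * (r + 1)))\<close>.\<close>

type_synonym table = "nat \<Rightarrow> nat \<Rightarrow> real"

definition agree :: "nat set \<Rightarrow> (nat \<Rightarrow> nat set) \<Rightarrow> table \<Rightarrow> table \<Rightarrow> bool" where
  "agree S T X Y \<longleftrightarrow> (\<forall>i\<in>S. \<forall>n\<in>T i. X i n = Y i n)"

lemma agree_mono: "agree S T X Y \<Longrightarrow> (\<And>i. i \<in> S \<Longrightarrow> T' i \<subseteq> T i) \<Longrightarrow> agree S T' X Y"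
  unfolding agree_def by blast

definition pulls :: "(nat \<times> real) list \<Rightarrow> nat \<Rightarrow> real list" where
  "pulls h i = map snd (filter (\<lambda>p. fst p = i) h)"

text \<open>The filler 0 is harmless: a demand or an output is relied on only after every entry that
  it may inspect has been observed.\<close>

definition obs :: "(nat \<times> real) list \<Rightarrow> table" where
  "obs h i n = (if n < length (pulls h i) then pulls h i ! n else 0)"

text \<open>\<open>N s X i\<close> is the total number of samples of arm \<open>i\<close> requested up to stage \<open>s\<close>; it may depend only on
  those entries of \<open>X\<close> that were requested by stage \<open>s - 1\<close> (see the locale below).\<close>

definition staged_policy ::
    "nat set \<Rightarrow> nat \<Rightarrow> (nat \<Rightarrow> table \<Rightarrow> nat \<Rightarrow> nat) \<Rightarrow> (table \<Rightarrow> nat) \<Rightarrow> policy" where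
  "staged_policy S F N out u h =
     (let lacking = (\<lambda>s i. i \<in> S \<and> length (pulls h i) < N s (obs h) i)
      in if \<exists>s\<le>F. \<exists>i. lacking s i
         then Pull (SOME i. lacking (LEAST s. s \<le> F \<and> (\<exists>i. lacking s i)) i)
         else Stop (out (obs h)))"

lemma hist_after_stop:
  assumes "P u (hist P u X t) = Stop a"
  shows "hist P u X (t + d) = hist P u X t"
  using assms by (induction d) (simp_all add: Let_def)

text \<open>\<open>good_run\<close> quantifies existentially over the stopping time; uniqueness ties
  it to the single final history of a run.\<close>

lemma hist_stop_unique:
  assumes "P u (hist P u X t) = Stop a" "P u (hist P u X t') = Stop a'"
  shows "hist P u X t = hist P u X t'" "a = a'"
proof -
  show *: "hist P u X t = hist P u X t'"
  proof (cases "t \<le> t'")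
    case True
    then show ?thesis using hist_after_stop[where P=P, OF assms(1), of "t' - t"] by simp
  next
    case False
    then show ?thesis using hist_after_stop[where P=P, OF assms(2), of "t - t'"] by simp
  qed
  with assms show "a = a'" by simp
qed

locale staged =
  fixes S :: "nat set" and F :: nat and N :: "nat \<Rightarrow> table \<Rightarrow> nat \<Rightarrow> nat" and out :: "table \<Rightarrow> nat"
  assumes finite_S: "finite S"
    and N_mono: "N s X i \<le> N (Suc s) X i"
    and N_0: "i \<in> S \<Longrightarrow> N 0 X i = N 0 Y i"
    and N_local: "agree S (\<lambda>i. {..<N s X i}) X Y \<Longrightarrow> s < F \<Longrightarrow> i \<in> S \<Longrightarrow> N (Suc s) X i = N (Suc s) Y i"
    and out_local: "agree S (\<lambda>i. {..<N F X i}) X Y \<Longrightarrow> out X = out Y"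
begin

lemma N_mono': "s \<le> s' \<Longrightarrow> N s X i \<le> N s' X i"
  by (rule lift_Suc_mono_le[of "\<lambda>s. N s X i"]) (auto simp: N_mono)

text \<open>Invariant of a run. The prefix condition makes \<open>obs h\<close> a faithful copy of a
  part of \<open>X\<close>; the cap by the final demand bounds the length of the history and so
  forces termination.\<close>

definition consistent :: "table \<Rightarrow> (nat \<times> real) list \<Rightarrow> bool" where
  "consistent X h \<longleftrightarrow> fst ` set h \<subseteq> S \<and>
     (\<forall>i\<in>S. length (pulls h i) \<le> N F X i \<and> (\<forall>n<length (pulls h i). pulls h i ! n = X i n))"

lemma length_pulls:
  assumes "fst ` set h \<subseteq> S"
  shows "length h = (\<Sum>i\<in>S. length (pulls h i))"
  using assms
proof (induction h)
  case Nil
  then show ?case by (simp add: pulls_def)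
next
  case (Cons p h)
  have "(\<Sum>i\<in>S. length (pulls (p # h) i)) = (\<Sum>i\<in>S. length (pulls h i) + (if fst p = i then 1 else 0))"
    by (intro sum.cong) (auto simp: pulls_def)
  also have "\<dots> = (\<Sum>i\<in>S. length (pulls h i)) + 1"
    using Cons.prems finite_S by (simp add: sum.distrib)
  finally show ?case using Cons by simp
qed

text \<open>Induction on the stage: once the earlier stages are served, \<open>obs h\<close> agrees
  with \<open>X\<close> on all entries that the next demand may inspect, so the demand computed from
  the history is the true one.\<close>

lemma consistent_stage:
  assumes c: "consistent X h"
    and full: "\<And>s' i. s' < s \<Longrightarrow> i \<in> S \<Longrightarrow> N s' (obs h) i \<le> length (pulls h i)"
    and s: "s \<le> F" and i: "i \<in> S"
  shows "N s (obs h) i = N s X i"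
  using full s i
proof (induction s arbitrary: i)
  case 0
  then show ?case using N_0 by blast
next
  case (Suc s)
  have "agree S (\<lambda>i. {..<N s (obs h) i}) (obs h) X"
    unfolding agree_def
  proof safe
    fix j n assume j: "j \<in> S" and n: "n < N s (obs h) j"
    have "N s (obs h) j \<le> length (pulls h j)" by (rule Suc.prems(1)) (use j in auto)
    with n j c show "obs h j n = X j n" by (auto simp: obs_def consistent_def)
  qed
  then show ?case using N_local Suc.prems by auto
qed

lemma consistent_step:
  assumes c: "consistent X h"
  shows "(\<exists>i. staged_policy S F N out u h = Pull i \<and> consistent X (h @ [(i, X i (length (pulls h i)))]))
       \<or> staged_policy S F N out u h = Stop (out X) \<and> length h = (\<Sum>i\<in>S. N F X i)"
proof -
  define lacking where "lacking = (\<lambda>s i. i \<in> S \<and> length (pulls h i) < N s (obs h) i)"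
  show ?thesis
  proof (cases "\<exists>s\<le>F. \<exists>i. lacking s i")
    case True
    \<comment> \<open>By minimality of \<open>s\<close> all earlier stages are served, which is what
      \<open>consistent_stage\<close> requires.\<close>
    define s where "s = (LEAST s. s \<le> F \<and> (\<exists>i. lacking s i))"
    define i where "i = (SOME i. lacking s i)"
    have s: "s \<le> F \<and> (\<exists>i. lacking s i)" unfolding s_def by (rule LeastI_ex) (use True in auto)
    then have i: "lacking s i" unfolding i_def by (metis someI_ex)
    have less: "N s' (obs h) j \<le> length (pulls h j)" if "s' < s" "j \<in> S" for s' j
    proof -
      have "\<not> (s' \<le> F \<and> (\<exists>i. lacking s' i))"
        using that(1) unfolding s_def by (rule not_less_Least)
      then show ?thesis using that s by (auto simp: lacking_def not_less)
    qed
    have "N s (obs h) i = N s X i"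
      using consistent_stage[OF c less] s i by (auto simp: lacking_def)
    then have lt: "length (pulls h i) < N F X i"
      using N_mono'[of s F X i] i s by (auto simp: lacking_def)
    have "staged_policy S F N out u h = Pull i"
      using True by (simp add: staged_policy_def Let_def lacking_def s_def i_def)
    moreover have "consistent X (h @ [(i, X i (length (pulls h i)))])"
      using c lt i by (auto simp: consistent_def pulls_def lacking_def nth_append less_Suc_eq)
    ultimately show ?thesis by blast
  next
    case False
    have full: "N s (obs h) j \<le> length (pulls h j)" if "s \<le> F" "j \<in> S" for s j
      using False that by (force simp: lacking_def)
    have eq: "N F (obs h) j = N F X j" if "j \<in> S" for j
      using consistent_stage[OF c, of F j] full that by auto
    have "agree S (\<lambda>i. {..<N F (obs h) i}) (obs h) X"
      unfolding agree_def
    proof safe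
      fix j n assume j: "j \<in> S" and n: "n < N F (obs h) j"
      with full[of F j] have "n < length (pulls h j)" by auto
      with c j show "obs h j n = X j n" by (auto simp: obs_def consistent_def)
    qed
    then have "out (obs h) = out X" by (rule out_local)
    moreover have "length (pulls h j) = N F X j" if "j \<in> S" for j
      using full[of F j] eq[OF that] c that by (auto simp: consistent_def intro: antisym)
    then have "length h = (\<Sum>i\<in>S. N F X i)"
      using length_pulls c by (auto simp: consistent_def)
    ultimately show ?thesis
      using False by (auto simp: staged_policy_def Let_def lacking_def)
  qed
qed

text \<open>A run that never stopped would lengthen a consistent history in every round, but the
  final demands bound that length.\<close>

lemma staged_policy_stops:
  defines "P \<equiv> staged_policy S F N out"
  shows "\<exists>t. P u (hist P u X t) = Stop (out X) \<and> length (hist P u X t) = (\<Sum>i\<in>S. N F X i)"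
proof (rule ccontr)
  assume *: "\<not> ?thesis"
  have "consistent X (hist P u X t) \<and> length (hist P u X t) = t" for t
  proof (induction t)
    case 0
    then show ?case by (simp add: consistent_def pulls_def)
  next
    case (Suc t)
    from consistent_step[of X "hist P u X t" u] Suc.IH *
    show ?case by (auto simp: P_def[symmetric] pulls_def Let_def)
  qed
  then have "t \<le> (\<Sum>i\<in>S. N F X i)" for t
    using length_pulls[of "hist P u X t"]
    by (metis (no_types, lifting) consistent_def sum_mono)
  from this[of "Suc (\<Sum>i\<in>S. N F X i)"] show False by simp
qed

text \<open>Reduces the success event to a property of the table alone, to be analysed without
  reference to histories.\<close>

lemma good_run_staged_policy:
  "good_run (staged_policy S F N out) S D eps B u X \<longleftrightarrow>
     out X \<in> S \<and> \<bar>mean_of (D (out X)) - Max ((\<lambda>i. mean_of (D i)) ` S)\<bar> \<le> eps \<and>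
     real (\<Sum>i\<in>S. N F X i) \<le> B"
  unfolding good_run_def
  using staged_policy_stops[of u X] hist_stop_unique[of "staged_policy S F N out" u X] by metis

end

subsection \<open>Keeping the better half\<close>

text \<open>Ties are broken by index, so this is a strict total order and the kept half has an exact
  size even when scores coincide.\<close>

definition beats :: "(nat \<Rightarrow> real) \<Rightarrow> nat \<Rightarrow> nat \<Rightarrow> bool" where
  "beats s j i \<longleftrightarrow> s i < s j \<or> s j = s i \<and> j < i"

definition rank :: "nat set \<Rightarrow> (nat \<Rightarrow> real) \<Rightarrow> nat \<Rightarrow> nat" where
  "rank A s i = card {j\<in>A. beats s j i}"

text \<open>Rounding up keeps a nonempty set nonempty and makes a singleton a fixed point.\<close>

definition top_half :: "nat set \<Rightarrow> (nat \<Rightarrow> real) \<Rightarrow> nat set" where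
  "top_half A s = {i\<in>A. rank A s i < (card A + 1) div 2}"

lemma rank_less:
  assumes "finite A" "beats s i j" "i \<in> A"
  shows "rank A s i < rank A s j"
  unfolding rank_def
  by (rule psubset_card_mono) (use assms in \<open>auto simp: beats_def\<close>)

lemma beats_cases: "i \<noteq> j \<Longrightarrow> beats s i j \<or> beats s j i"
  by (auto simp: beats_def)

lemma top_half_subset: "top_half A s \<subseteq> A"
  by (auto simp: top_half_def)

lemma top_half_cong: "(\<And>i. i \<in> A \<Longrightarrow> s i = t i) \<Longrightarrow> top_half A s = top_half A t"
  unfolding top_half_def rank_def beats_def
  by (intro Collect_cong conj_cong refl arg_cong2[of _ _ _ _ "(<)"] arg_cong[of _ _ card]) auto

lemma card_top_half:
  assumes "finite A"
  shows "card (top_half A s) = (card A + 1) div 2"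
proof -
  have inj: "inj_on (rank A s) A"
    by (rule inj_onI) (metis assms beats_cases rank_less less_irrefl)
  have "rank A s i < card A" if "i \<in> A" for i
    unfolding rank_def by (rule psubset_card_mono) (use assms that in \<open>auto simp: beats_def\<close>)
  then have "rank A s ` A \<subseteq> {..<card A}" by auto
  then have img: "rank A s ` A = {..<card A}"
    by (intro card_subset_eq) (auto simp: card_image[OF inj])
  have "rank A s ` top_half A s = {..<(card A + 1) div 2}"
  proof safe
    fix r assume r: "r < (card A + 1) div 2"
    then have "r < card A" by linarith
    then obtain i where "i \<in> A" "r = rank A s i" using img by blast
    with r show "r \<in> rank A s ` top_half A s" by (auto simp: top_half_def)
  qed (auto simp: top_half_def)
  then show ?thesis
    using card_image[OF inj_on_subset[OF inj top_half_subset[of A s]]] by simp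
qed

lemma top_half_small:
  assumes "finite A" "card A \<le> 1"
  shows "top_half A s = A"
  by (rule card_subset_eq[OF assms(1) top_half_subset]) (use assms in \<open>auto simp: card_top_half le_Suc_eq\<close>)

lemma top_half_beats:
  assumes "finite A" "i \<in> A - top_half A s" "j \<in> top_half A s"
  shows "s i \<le> s j"
proof -
  have "rank A s j < rank A s i" using assms by (auto simp: top_half_def)
  moreover have "i \<noteq> j" using assms by auto
  ultimately have "beats s j i" 
    using rank_less[OF assms(1), of s i j] beats_cases[of i j s] assms by auto
  then show ?thesis by (auto simp: beats_def)
qed

subsection \<open>Exponential moments of distributions on the unit interval\<close>

text \<open>Extends to negative exponents the quadratic bound that \<open>exp_bound\<close> gives on
  the interval from 0 to 1. The reciprocal of the Taylor polynomial lies below the right-hand side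
  because their product test leaves only nonnegative terms above 1.\<close>

lemma exp_minus_le_quadratic:
  fixes y :: real
  assumes "0 \<le> y"
  shows "exp (- y) \<le> 1 - y + y\<^sup>2"
proof -
  have pos: "0 < 1 + y + y\<^sup>2 / 2" using assms by (intro add_pos_nonneg) auto
  have "1 + y + y\<^sup>2 / 2 \<le> exp y" by (rule exp_lower_Taylor_quadratic[OF assms])
  then have "exp (- y) \<le> 1 / (1 + y + y\<^sup>2 / 2)"
    using pos by (simp add: exp_minus inverse_eq_divide frac_le)
  also have "\<dots> \<le> 1 - y + y\<^sup>2"
  proof -
    have "(1 - y + y\<^sup>2) * (1 + y + y\<^sup>2 / 2) = 1 + (y\<^sup>2 + y ^ 3 + y ^ 4) / 2"
      by (simp add: power2_eq_square power3_eq_cube power4_eq_xxxx field_simps)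
    also have "\<dots> \<ge> 1" using assms by simp
    finally show ?thesis using pos by (simp add: divide_le_eq)
  qed
  finally show ?thesis .
qed

text \<open>For two independent draws this is the unbiased estimate of the variance, which is why
  samples are consumed in pairs.\<close>

definition half_sq :: "real \<times> real \<Rightarrow> real" where
  "half_sq z = (fst z - snd z)\<^sup>2 / 2"

lemma half_sq_measurable [measurable]: "half_sq \<in> borel_measurable (borel \<Otimes>\<^sub>M borel)"
  unfolding half_sq_def by measurable

lemma half_sq_bounds: "0 \<le> x \<Longrightarrow> x \<le> 1 \<Longrightarrow> 0 \<le> y \<Longrightarrow> y \<le> 1 \<Longrightarrow> 0 \<le> half_sq (x, y) \<and> half_sq (x, y) \<le> 1 / 2"
  using abs_square_le_1[of "x - y"] by (auto simp: half_sq_def)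

locale unit_distribution = prob_space D for D :: "real measure" +
  assumes sets_D [measurable_cong, simp]: "sets D = sets borel"
    and AE_unit: "AE x in D. 0 \<le> x \<and> x \<le> 1"
begin

abbreviation "\<theta> \<equiv> mean_of D"
abbreviation "V \<equiv> var_of D"
abbreviation "DD \<equiv> D \<Otimes>\<^sub>M D"

sublocale DD: pair_prob_space D D ..

lemma space_D [simp]: "space D = UNIV"
  using sets_eq_imp_space_eq[OF sets_D] by simp

lemma prob_UNIV [simp]: "prob UNIV = 1"
  using prob_space by simp

lemma integrable_bounded:
  fixes f :: "real \<Rightarrow> real"
  assumes [measurable]: "f \<in> borel_measurable borel" and B: "\<And>x. 0 \<le> x \<Longrightarrow> x \<le> 1 \<Longrightarrow> \<bar>f x\<bar> \<le> B"
  shows "integrable D f"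
proof (rule integrable_const_bound[where B=B])
  show "AE x in D. norm (f x) \<le> B"
    using AE_unit by eventually_elim (simp add: B)
qed simp

lemma integrable_id: "integrable D (\<lambda>x. x)"
  by (rule integrable_bounded[where B=1]) auto

lemma integrable_sq: "integrable D (\<lambda>x. x\<^sup>2)"
  by (rule integrable_bounded[where B=1]) (auto simp: power_le_one)

lemma mean_bounds: "0 \<le> \<theta>" "\<theta> \<le> 1"
proof -
  show "0 \<le> \<theta>" unfolding mean_of_def
  proof (rule integral_nonneg_AE)
    show "AE x in D. 0 \<le> x" using AE_unit by eventually_elim simp
  qed
  have "\<theta> \<le> (\<integral>x. 1 \<partial>D)" unfolding mean_of_def
  proof (rule integral_mono_AE)
    show "AE x in D. x \<le> 1" using AE_unit by eventually_elim simp
  qed (simp_all add: integrable_id)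
  then show "\<theta> \<le> 1" by (simp add: prob_space)
qed

lemma var_nonneg: "0 \<le> V"
  unfolding var_of_def by simp

lemma var_eq: "V = (\<integral>x. x\<^sup>2 \<partial>D) - \<theta>\<^sup>2"
proof -
  have "V = (\<integral>x. x\<^sup>2 - (2 * \<theta>) * x + \<theta>\<^sup>2 \<partial>D)"
    unfolding var_of_def by (intro Bochner_Integration.integral_cong) (auto simp: power2_eq_square algebra_simps)
  also have "\<dots> = (\<integral>x. x\<^sup>2 \<partial>D) - (2 * \<theta>) * \<theta> + \<theta>\<^sup>2"
    using integrable_id integrable_sq
    by (subst Bochner_Integration.integral_add Bochner_Integration.integral_diff integral_mult_right_zero, simp_all add: prob_space)+
       (simp add: mean_of_def[symmetric])
  finally show ?thesis by (simp add: power2_eq_square)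
qed

lemma var_le_1: "V \<le> 1"
proof -
  have "(\<integral>x. x\<^sup>2 \<partial>D) \<le> (\<integral>x. 1 \<partial>D)"
  proof (rule integral_mono_AE)
    show "AE x in D. x\<^sup>2 \<le> 1" using AE_unit by eventually_elim (simp add: power_le_one)
  qed (simp_all add: integrable_sq)
  then have "(\<integral>x. x\<^sup>2 \<partial>D) \<le> 1" by (simp add: prob_space)
  moreover have "0 \<le> \<theta>\<^sup>2" by simp
  ultimately show ?thesis using var_eq by linarith
qed

lemma AE_DD: "AE z in DD. 0 \<le> fst z \<and> fst z \<le> 1 \<and> 0 \<le> snd z \<and> snd z \<le> 1"
proof (rule DD.AE_pair_measure)
  show "AE x in D. AE y in D. 0 \<le> fst (x, y) \<and> fst (x, y) \<le> 1 \<and> 0 \<le> snd (x, y) \<and> snd (x, y) \<le> 1"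
    using AE_unit
  proof eventually_elim
    case (elim x)
    show ?case using AE_unit by eventually_elim (use elim in simp)
  qed
qed measurable

lemma integrable_DD:
  fixes f :: "real \<times> real \<Rightarrow> real"
  assumes [measurable]: "f \<in> borel_measurable (borel \<Otimes>\<^sub>M borel)"
    and B: "\<And>x y. 0 \<le> x \<Longrightarrow> x \<le> 1 \<Longrightarrow> 0 \<le> y \<Longrightarrow> y \<le> 1 \<Longrightarrow> \<bar>f (x, y)\<bar> \<le> B"
  shows "integrable DD f"
proof (rule DD.P.integrable_const_bound[where B=B])
  show "AE z in DD. norm (f z) \<le> B"
    using AE_DD by eventually_elim (use B in \<open>auto simp: split_beta\<close>)
qed simp

lemma integrable_exp_DD:
  fixes f :: "real \<times> real \<Rightarrow> real"
  assumes [measurable]: "f \<in> borel_measurable (borel \<Otimes>\<^sub>M borel)"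
    and B: "\<And>x y. 0 \<le> x \<Longrightarrow> x \<le> 1 \<Longrightarrow> 0 \<le> y \<Longrightarrow> y \<le> 1 \<Longrightarrow> f (x, y) \<le> B"
  shows "integrable DD (\<lambda>z. exp (f z))"
  by (rule integrable_DD[where B="exp B"]) (simp_all add: B)

lemma integral_DD_fst:
  fixes f :: "real \<Rightarrow> real"
  assumes [measurable]: "f \<in> borel_measurable borel" and B: "\<And>x. 0 \<le> x \<Longrightarrow> x \<le> 1 \<Longrightarrow> \<bar>f x\<bar> \<le> B"
  shows "(\<integral>z. f (fst z) \<partial>DD) = (\<integral>x. f x \<partial>D)"
proof -
  have "integrable DD (\<lambda>z. f (fst z))" by (rule integrable_DD[where B=B]) (auto simp: B)
  from DD.integral_fst'[OF this] show ?thesis by (simp add: prob_space)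
qed

lemma integrable_half_sq: "integrable DD half_sq"
  proof (rule integrable_DD[where B="1/2"])
  fix x y :: real assume "0 \<le> x" "x \<le> 1" "0 \<le> y" "y \<le> 1"
  from half_sq_bounds[OF this] show "\<bar>half_sq (x, y)\<bar> \<le> 1/2" by simp
qed simp

lemma integral_half_sq: "(\<integral>z. half_sq z \<partial>DD) = V"
proof -
  have "(\<integral>z. half_sq z \<partial>DD) = (\<integral>x. (\<integral>y. half_sq (x, y) \<partial>D) \<partial>D)"
    using DD.integral_fst'[OF integrable_half_sq] by simp
  also have "\<dots> = (\<integral>x. (1/2) * x\<^sup>2 - \<theta> * x + (\<integral>y. y\<^sup>2 \<partial>D) / 2 \<partial>D)"
  proof (rule Bochner_Integration.integral_cong[OF refl])
    fix x :: real
    have "(\<integral>y. half_sq (x, y) \<partial>D) = (\<integral>y. x\<^sup>2 / 2 - x * y + (1/2) * y\<^sup>2 \<partial>D)"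
      by (intro Bochner_Integration.integral_cong) (auto simp: half_sq_def power2_eq_square field_simps)
    also have "\<dots> = x\<^sup>2 / 2 - x * \<theta> + (1/2) * (\<integral>y. y\<^sup>2 \<partial>D)"
      using integrable_id integrable_sq
      by (subst Bochner_Integration.integral_add Bochner_Integration.integral_diff integral_mult_right_zero, simp_all add: prob_space)+
         (simp add: mean_of_def[symmetric])
    finally show "(\<integral>y. half_sq (x, y) \<partial>D) = (1/2) * x\<^sup>2 - \<theta> * x + (\<integral>y. y\<^sup>2 \<partial>D) / 2" by simp
  qed
  also have "\<dots> = (1/2) * (\<integral>x. x\<^sup>2 \<partial>D) - \<theta> * \<theta> + (\<integral>y. y\<^sup>2 \<partial>D) / 2"
    using integrable_id integrable_sq
    by (subst Bochner_Integration.integral_add Bochner_Integration.integral_diff integral_mult_right_zero, simp_all add: prob_space)+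
       (simp add: mean_of_def[symmetric])
  finally show ?thesis using var_eq by (simp add: power2_eq_square)
qed

text \<open>Since \<open>half_sq\<close> takes values between 0 and 1/2, its exponential lies below
  a linear function. The moment is thus governed by the mean \<open>V\<close> alone, which yields
  concentration up to a constant factor.\<close>

lemma exp_half_sq_le: "(\<integral>z. exp (half_sq z) \<partial>DD) \<le> exp (2 * V)"
proof -
  have "(\<integral>z. exp (half_sq z) \<partial>DD) \<le> (\<integral>z. 1 + 2 * half_sq z \<partial>DD)"
  proof (rule integral_mono_AE)
    show "integrable DD (\<lambda>z. exp (half_sq z))"
    proof (rule integrable_DD[where B="exp (1/2)"])
      fix x y :: real assume "0 \<le> x" "x \<le> 1" "0 \<le> y" "y \<le> 1"
      from half_sq_bounds[OF this] show "\<bar>exp (half_sq (x, y))\<bar> \<le> exp (1/2)" by simp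
    qed simp
    show "AE z in DD. exp (half_sq z) \<le> 1 + 2 * half_sq z"
      using AE_DD
    proof eventually_elim
      case (elim z)
      then have b: "0 \<le> half_sq z" "half_sq z \<le> 1/2" using half_sq_bounds[of "fst z" "snd z"] by auto
      show ?case by (rule real_exp_bound_lemma) (use b in auto)
    qed
  qed (simp add: integrable_half_sq)
  also have "\<dots> = 1 + 2 * V"
    using integrable_half_sq by (simp add: integral_half_sq DD.P.prob_space)
  also have "\<dots> \<le> exp (2 * V)" by (rule exp_ge_add_one_self)
  finally show ?thesis .
qed

text \<open>The linear majorant comes from \<open>exp_minus_le_quadratic\<close> and
  \<open>h * h \<le> h / 2\<close>.\<close>

lemma exp_neg_half_sq_le: "(\<integral>z. exp (- half_sq z) \<partial>DD) \<le> exp (- V / 2)"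
proof -
  have "(\<integral>z. exp (- half_sq z) \<partial>DD) \<le> (\<integral>z. 1 - (1/2) * half_sq z \<partial>DD)"
  proof (rule integral_mono_AE)
    show "integrable DD (\<lambda>z. exp (- half_sq z))"
    proof (rule integrable_DD[where B="1"])
      fix x y :: real assume "0 \<le> x" "x \<le> 1" "0 \<le> y" "y \<le> 1"
      from half_sq_bounds[OF this] show "\<bar>exp (- half_sq (x, y))\<bar> \<le> 1" by simp
    qed simp
    show "AE z in DD. exp (- half_sq z) \<le> 1 - (1/2) * half_sq z"
      using AE_DD
    proof eventually_elim
      case (elim z)
      define h where "h = half_sq z"
      have b: "0 \<le> h" "h \<le> 1/2" using half_sq_bounds[of "fst z" "snd z"] elim by (auto simp: h_def)
      have "exp (- h) \<le> 1 - h + h\<^sup>2" by (rule exp_minus_le_quadratic) (use b in auto)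
      also have "\<dots> \<le> 1 - (1/2) * h"
        using mult_left_mono[of h "1/2" h] b by (simp add: power2_eq_square)
      finally show ?case by (simp add: h_def)
    qed
  qed (simp add: integrable_half_sq)
  also have "\<dots> = 1 + (- (1/2) * V)"
    using integrable_half_sq by (simp add: integral_half_sq DD.P.prob_space)
  also have "\<dots> \<le> exp (- (1/2) * V)" by (rule exp_ge_add_one_self)
  finally show ?thesis by simp
qed

text \<open>A Bernstein-type bound for both signs of \<open>s\<close>. The centred draw has second
  moment \<open>V\<close>; the penalty term satisfies \<open>h * h \<le> h / 2\<close>, so its
  second moment is at most \<open>V / 2\<close>. Splitting the square of the sum doubles both, and
  \<open>2 * V + V\<close> is the 3 in the exponent.\<close>

lemma exp_penalized_le:
  assumes l: "0 \<le> l" "l \<le> 1" and s: "\<bar>s\<bar> \<le> 1/2"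
  shows "(\<integral>z. exp (s * (fst z - l * half_sq z)) \<partial>DD) \<le> exp (s * (\<theta> - l * V) + 3 * s\<^sup>2 * V)"
proof -
  define w where "w z = (fst z - \<theta>) - l * (half_sq z - V)" for z
  \<comment> \<open>Pointwise majorant of \<open>exp (s * w z)\<close>: one plus the linear term
    plus a bound of the square. It is linear in functions of known mean, so its integral can be read
    off.\<close>
  define g where "g z = 1 + s * (fst z - \<theta>) - s * l * (half_sq z - V)
      + s\<^sup>2 * (2 * (fst z - \<theta>)\<^sup>2 + half_sq z - 4 * V * half_sq z + 2 * V\<^sup>2)" for z
  have [measurable]: "w \<in> borel_measurable (borel \<Otimes>\<^sub>M borel)" unfolding w_def by measurable
  have wb: "\<bar>w (x, y)\<bar> \<le> 2" if "0 \<le> x" "x \<le> 1" "0 \<le> y" "y \<le> 1" for x y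
  proof -
    have "\<bar>l * (half_sq (x, y) - V)\<bar> \<le> 1 * 1"
      unfolding abs_mult by (rule mult_mono) (use half_sq_bounds[OF that] l var_nonneg var_le_1 in auto)
    then show ?thesis using that mean_bounds unfolding w_def by auto
  qed
  have int1: "integrable DD (\<lambda>z. fst z)" by (rule integrable_DD[where B=1]) auto
  have int2: "integrable DD (\<lambda>z. (fst z - \<theta>)\<^sup>2)"
  proof (rule integrable_DD[where B=1])
    fix x y :: real assume "0 \<le> x" "x \<le> 1" "0 \<le> y" "y \<le> 1"
    then show "\<bar>(fst (x, y) - \<theta>)\<^sup>2\<bar> \<le> 1" using mean_bounds by (simp add: abs_square_le_1)
  qed simp
  have E1: "(\<integral>z. fst z \<partial>DD) = \<theta>"
    using integral_DD_fst[of "\<lambda>x. x" 1] by (simp add: mean_of_def)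
  have E2: "(\<integral>z. (fst z - \<theta>)\<^sup>2 \<partial>DD) = V"
    unfolding var_of_def
    by (rule integral_DD_fst[where B=1]) (use mean_bounds in \<open>auto simp: abs_square_le_1\<close>)
  have "(\<integral>z. exp (s * w z) \<partial>DD) \<le> (\<integral>z. g z \<partial>DD)"
  proof (rule integral_mono_AE)
    show "integrable DD (\<lambda>z. exp (s * w z))"
    proof (rule integrable_DD[where B="exp 1"])
      fix x y :: real assume "0 \<le> x" "x \<le> 1" "0 \<le> y" "y \<le> 1"
      from wb[OF this] have "\<bar>s * w (x, y)\<bar> \<le> 1/2 * 2" unfolding abs_mult using s by (intro mult_mono) auto
      then show "\<bar>exp (s * w (x, y))\<bar> \<le> exp 1" by simp
    qed simp
    show "integrable DD g"
      unfolding g_def using int1 int2 integrable_half_sq by auto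
    show "AE z in DD. exp (s * w z) \<le> g z"
      using AE_DD
    proof eventually_elim
      case (elim z)
      define h where "h = half_sq z"
      have b: "0 \<le> h" "h \<le> 1/2" using half_sq_bounds[of "fst z" "snd z"] elim by (auto simp: h_def)
      have "\<bar>w z\<bar> \<le> 2" using wb[of "fst z" "snd z"] elim by auto
      then have "\<bar>s * w z\<bar> \<le> 1/2 * 2" unfolding abs_mult using s by (intro mult_mono) auto
      then have "exp (s * w z) \<le> 1 + s * w z + (s * w z)\<^sup>2"
        using exp_bound[of "s * w z"] exp_minus_le_quadratic[of "- (s * w z)"] by (cases "0 \<le> s * w z") auto
      also have "(s * w z)\<^sup>2 \<le> s\<^sup>2 * (2 * (fst z - \<theta>)\<^sup>2 + h - 4 * V * h + 2 * V\<^sup>2)"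
      proof -
        have "(w z)\<^sup>2 \<le> 2 * (fst z - \<theta>)\<^sup>2 + 2 * (l * (h - V))\<^sup>2"
          using zero_le_power2[of "(fst z - \<theta>) + l * (h - V)"]
          unfolding w_def h_def[symmetric] by (simp add: power2_eq_square algebra_simps)
        also have "(l * (h - V))\<^sup>2 \<le> 1 * (h - V)\<^sup>2"
          unfolding power_mult_distrib by (rule mult_right_mono) (use l in \<open>auto simp: power_le_one\<close>)
        \<comment> \<open>Replaces the square of \<open>h\<close> by \<open>h / 2\<close>, leaving
          an expression linear in \<open>h\<close>.\<close>
        also have "2 * (1 * (h - V)\<^sup>2) \<le> h - 4 * V * h + 2 * V\<^sup>2"
          using mult_left_mono[of h "1/2" h] b by (simp add: power2_eq_square algebra_simps)
        finally have "(w z)\<^sup>2 \<le> 2 * (fst z - \<theta>)\<^sup>2 + h - 4 * V * h + 2 * V\<^sup>2" by simp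
        then show ?thesis unfolding power_mult_distrib by (intro mult_left_mono) auto
      qed
      finally show ?case unfolding g_def w_def h_def by (simp add: algebra_simps)
    qed
  qed
  also have "(\<integral>z. g z \<partial>DD) = 1 + s\<^sup>2 * (2 * V + V - 4 * V * V + 2 * V\<^sup>2)"
    unfolding g_def using int1 int2 integrable_half_sq
    by (simp add: E1 E2 integral_half_sq DD.P.prob_space)
  also have "\<dots> \<le> 1 + 3 * s\<^sup>2 * V"
    using zero_le_power2[of "s * V"] by (simp add: power2_eq_square algebra_simps)
  also have "\<dots> \<le> exp (3 * s\<^sup>2 * V)" by (rule exp_ge_add_one_self)
  finally have le: "(\<integral>z. exp (s * w z) \<partial>DD) \<le> exp (3 * s\<^sup>2 * V)" .
  have "(\<integral>z. exp (s * (fst z - l * half_sq z)) \<partial>DD) = (\<integral>z. exp (s * (\<theta> - l * V)) * exp (s * w z) \<partial>DD)"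
    by (intro Bochner_Integration.integral_cong) (auto simp: w_def algebra_simps simp flip: exp_add)
  also have "\<dots> \<le> exp (s * (\<theta> - l * V)) * exp (3 * s\<^sup>2 * V)"
    using le by simp
  finally show ?thesis by (simp add: exp_add)
qed

end

subsection \<open>The table of rewards\<close>

definition pair :: "table \<Rightarrow> nat \<times> nat \<Rightarrow> real \<times> real" where
  "pair X q = (X (fst q) (2 * snd q), X (fst q) (2 * snd q + 1))"

definition table_space :: "nat set \<Rightarrow> (nat \<Rightarrow> real measure) \<Rightarrow> table measure" where
  "table_space S D = (\<Pi>\<^sub>M i\<in>S. \<Pi>\<^sub>M n\<in>(UNIV::nat set). D i)"

locale arms =
  fixes S :: "nat set" and D :: "nat \<Rightarrow> real measure"
  assumes finite_S: "finite S" and S_nonempty: "S \<noteq> {}" and arm: "unit_distribution (D i)"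
begin

sublocale arm: unit_distribution "D i" for i by (rule arm)

abbreviation "T \<equiv> table_space S D"

lemma prob_space_T: "prob_space T"
  unfolding table_space_def by (intro prob_space_PiM arm.prob_space_axioms)

sublocale T: prob_space T by (rule prob_space_T)

lemma sets_T: "sets T = sets (\<Pi>\<^sub>M i\<in>S. \<Pi>\<^sub>M n\<in>(UNIV::nat set). borel)"
  unfolding table_space_def by (intro sets_PiM_cong refl arm.sets_D)

lemma space_T: "X \<in> space T \<longleftrightarrow> X \<in> extensional S"
  using sets_eq_imp_space_eq[OF sets_T] by (auto simp: space_PiM PiE_def)

lemma entry_measurable [measurable]: "i \<in> S \<Longrightarrow> (\<lambda>X. X i n) \<in> borel_measurable T"
proof -
  assume i: "i \<in> S"
  have "(\<lambda>X. X i n) \<in> T \<rightarrow>\<^sub>M D i"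
    unfolding table_space_def
    by (rule measurable_compose[OF measurable_component_singleton[OF i] measurable_component_singleton]) simp
  then show ?thesis by (simp cong: measurable_cong_sets)
qed

lemma distr_entry: "i \<in> S \<Longrightarrow> distr T borel (\<lambda>X. X i n) = D i"
proof -
  assume i: "i \<in> S"
  have "distr T borel (\<lambda>X. X i n) = distr T (D i) (\<lambda>X. X i n)"
    by (intro distr_cong) simp_all
  also have "\<dots> = distr (distr T (\<Pi>\<^sub>M n\<in>(UNIV::nat set). D i) (\<lambda>X. X i)) (D i) (\<lambda>x. x n)"
    unfolding table_space_def by (subst distr_distr) (use i in \<open>auto simp: comp_def\<close>)
  also have "distr T (\<Pi>\<^sub>M n\<in>(UNIV::nat set). D i) (\<lambda>X. X i) = (\<Pi>\<^sub>M n\<in>(UNIV::nat set). D i)"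
    unfolding table_space_def
    by (rule distr_PiM_component[where M="\<lambda>i. \<Pi>\<^sub>M n\<in>(UNIV::nat set). D i", OF _ i])
       (intro prob_space_PiM arm.prob_space_axioms)
  also have "distr \<dots> (D i) (\<lambda>x. x n) = D i"
    by (rule distr_PiM_component[where M="\<lambda>n. D i"]) (auto intro: arm.prob_space_axioms)
  finally show ?thesis .
qed

text \<open>The nested product measure must be flattened to a product over pairs of arm and sample
  index. Equality of the two laws is checked on finite boxes.\<close>

lemma indep_entries: "T.indep_vars (\<lambda>_. borel) (\<lambda>p X. X (fst p) (snd p)) (S \<times> UNIV)"
proof (subst T.indep_vars_iff_distr_eq_PiM')
  let ?M = "\<lambda>p :: nat \<times> nat. D (fst p)"
  let ?f = "\<lambda>X :: table. \<lambda>p\<in>S \<times> UNIV. X (fst p) (snd p)"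
  interpret out: product_prob_space "\<lambda>i. \<Pi>\<^sub>M n\<in>(UNIV::nat set). D i" S
    by (intro product_prob_spaceI prob_space_PiM arm.prob_space_axioms)
  interpret inn: product_prob_space "\<lambda>_::nat. D i" UNIV for i
    by (intro product_prob_spaceI arm.prob_space_axioms)
  interpret all: product_prob_space ?M "S \<times> UNIV"
    by (intro product_prob_spaceI arm.prob_space_axioms)
  have f [measurable]: "?f \<in> T \<rightarrow>\<^sub>M PiM (S \<times> UNIV) (\<lambda>_. borel)"
    by (rule measurable_restrict) auto
  have "distr T (PiM (S \<times> UNIV) (\<lambda>_. borel)) ?f = PiM (S \<times> UNIV) ?M"
  proof (rule measure_eqI_PiM_infinite)
    show "sets (distr T (PiM (S \<times> UNIV) (\<lambda>_. borel)) ?f) = sets (PiM (S \<times> UNIV) ?M)"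
      by (simp cong: sets_PiM_cong)
    show "finite_measure (distr T (PiM (S \<times> UNIV) (\<lambda>_. borel)) ?f)"
      by (intro prob_space.finite_measure T.prob_space_distr f)
    fix A and J :: "(nat \<times> nat) set"
    assume J: "finite J" "J \<subseteq> S \<times> UNIV" and A: "\<And>p. p \<in> J \<Longrightarrow> A p \<in> sets (D (fst p))"
    \<comment> \<open>Slicing the index set \<open>J\<close> by arms turns a flat box into a product
      over arms of cylinders, whose measure the nested product gives by applying the product formula
      twice.\<close>
    define K where "K i = {n. (i, n) \<in> J}" for i
    have J_eq: "J = Sigma S K" using J by (auto simp: K_def)
    have finK: "finite (K i)" for i
      using finite_imageI[OF J(1), of snd] by (rule rev_finite_subset) (force simp: K_def)
    define E where "E i = prod_emb UNIV (\<lambda>_. D i) (K i) (\<Pi>\<^sub>E n\<in>K i. A (i, n))" for i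
    have AK: "A (i, n) \<in> sets (D i)" if "n \<in> K i" for i n using A[of "(i, n)"] that by (auto simp: K_def)
    have E_meas: "E i \<in> sets (\<Pi>\<^sub>M n\<in>(UNIV::nat set). D i)" for i
      unfolding E_def by (rule sets_PiM_I) (use finK AK in auto)
    have emb_meas: "prod_emb (S \<times> UNIV) ?M J (Pi\<^sub>E J A) \<in> sets (PiM (S \<times> UNIV) ?M)"
      by (rule sets_PiM_I) (use J A in auto)
    have "emeasure (distr T (PiM (S \<times> UNIV) (\<lambda>_. borel)) ?f) (prod_emb (S \<times> UNIV) ?M J (Pi\<^sub>E J A))
        = emeasure T (?f -` prod_emb (S \<times> UNIV) ?M J (Pi\<^sub>E J A) \<inter> space T)"
      by (rule emeasure_distr) (use emb_meas in \<open>simp_all cong: sets_PiM_cong\<close>)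
    also have "?f -` prod_emb (S \<times> UNIV) ?M J (Pi\<^sub>E J A) \<inter> space T = Pi\<^sub>E S E"
      using J by (auto simp: prod_emb_def space_T E_def K_def PiE_def Pi_def extensional_def
          restrict_def space_PiM fun_eq_iff)
    also have "emeasure T (Pi\<^sub>E S E) = (\<Prod>i\<in>S. emeasure (\<Pi>\<^sub>M n\<in>(UNIV::nat set). D i) (E i))"
      unfolding table_space_def by (rule out.emeasure_PiM) (use finite_S E_meas in auto)
    also have "\<dots> = (\<Prod>i\<in>S. \<Prod>n\<in>K i. emeasure (D i) (A (i, n)))"
      unfolding E_def by (intro prod.cong refl inn.emeasure_PiM_emb) (use finK AK in auto)
    also have "\<dots> = (\<Prod>p\<in>J. emeasure (D (fst p)) (A p))"
      unfolding J_eq by (subst prod.Sigma) (use finite_S finK in \<open>auto simp: split_beta\<close>)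
    also have "\<dots> = emeasure (PiM (S \<times> UNIV) ?M) (prod_emb (S \<times> UNIV) ?M J (Pi\<^sub>E J A))"
      by (rule all.emeasure_PiM_emb[symmetric]) (use J A in auto)
    finally show "emeasure (distr T (PiM (S \<times> UNIV) (\<lambda>_. borel)) ?f) (prod_emb (S \<times> UNIV) ?M J (Pi\<^sub>E J A))
        = emeasure (PiM (S \<times> UNIV) ?M) (prod_emb (S \<times> UNIV) ?M J (Pi\<^sub>E J A))" .
  qed simp
  also have "\<dots> = (\<Pi>\<^sub>M p\<in>S \<times> UNIV. distr T borel (\<lambda>X. X (fst p) (snd p)))"
    by (intro PiM_cong refl) (auto simp: distr_entry)
  finally show "distr T (PiM (S \<times> UNIV) (\<lambda>_. borel)) ?f
      = (\<Pi>\<^sub>M p\<in>S \<times> UNIV. distr T borel (\<lambda>X. X (fst p) (snd p)))" .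
qed (use S_nonempty in auto)

text \<open>\<open>J\<close> selects sample indices, the same for every arm; disjoint selections
  give independent events.\<close>

definition determined_by :: "nat set \<Rightarrow> (table \<Rightarrow> 'b) \<Rightarrow> bool" where
  "determined_by J f \<longleftrightarrow> (\<forall>X Y. agree S (\<lambda>_. J) X Y \<longrightarrow> f X = f Y)"

text \<open>A predicate determined by \<open>J\<close> factors through the projection to those
  columns: \<open>ext\<close> rebuilds a table from them, with 0 elsewhere, on which the predicate
  has the same value. Projections to disjoint columns are independent.\<close>

lemma prob_determined_by_Int:
  assumes [measurable]: "Measurable.pred T P" "Measurable.pred T Q"
    and P: "determined_by I P" and Q: "determined_by J Q" and IJ: "I \<inter> J = {}"
  shows "\<P>(X in T. P X \<and> Q X) = \<P>(X in T. P X) * \<P>(X in T. Q X)"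
proof -
  define ext :: "nat set \<Rightarrow> (nat \<times> nat \<Rightarrow> real) \<Rightarrow> table" where
    "ext K w = (\<lambda>i\<in>S. \<lambda>n. if n \<in> K then w (i, n) else 0)" for K w
  have ext [measurable]: "ext K \<in> PiM (S \<times> K) (\<lambda>_. borel) \<rightarrow>\<^sub>M T" for K
  proof -
    have "ext K \<in> PiM (S \<times> K) (\<lambda>_. borel) \<rightarrow>\<^sub>M (\<Pi>\<^sub>M i\<in>S. \<Pi>\<^sub>M n\<in>(UNIV::nat set). borel)"
    proof -
      have "(\<lambda>w. if n \<in> K then w (i, n) else 0) \<in> borel_measurable (PiM (S \<times> K) (\<lambda>_. borel))" if "i \<in> S" for i n
        using that by (cases "n \<in> K") auto
      then show ?thesis
        unfolding ext_def
        by (intro measurable_restrict) (rule measurable_PiM_single', auto simp: extensional_def)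
    qed
    then show ?thesis by (simp cong: measurable_cong_sets add: sets_T)
  qed
  define proj where "proj K X = restrict (\<lambda>p. X (fst p) (snd p)) (S \<times> K)" for K and X :: table
  have agree: "agree S (\<lambda>_. K) (ext K (proj K X)) X" for K X
    by (auto simp: agree_def ext_def proj_def)
  have "T.indep_var (PiM (S \<times> I) (\<lambda>_. borel)) (proj I) (PiM (S \<times> J) (\<lambda>_. borel)) (proj J)"
    unfolding proj_def by (rule T.indep_var_restrict[OF indep_entries]) (use IJ in auto)
  from T.indep_var_compose[OF this ext ext]
  have "T.indep_var T (ext I \<circ> proj I) T (ext J \<circ> proj J)" .
  from T.prob_indep_random_variable[OF this, of "{X \<in> space T. P X}" "{X \<in> space T. Q X}"]
  have eq: "\<P>(X in T. ext I (proj I X) \<in> {X \<in> space T. P X} \<and> ext J (proj J X) \<in> {X \<in> space T. Q X})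
    = \<P>(X in T. ext I (proj I X) \<in> {X \<in> space T. P X}) * \<P>(X in T. ext J (proj J X) \<in> {X \<in> space T. Q X})"
    by simp
  have sp: "ext K w \<in> space T" for K w by (simp add: space_T ext_def)
  have "P (ext I (proj I X)) = P X" "Q (ext J (proj J X)) = Q X" for X
    using P Q agree unfolding determined_by_def by blast+
  with eq sp show ?thesis by simp
qed

text \<open>Substitutes a random set for a fixed one at no loss. Splitting by the value of
  \<open>g\<close> gives, by independence, a convex combination of the probabilities for fixed sets,
  so the number of candidate sets does not enter.\<close>

lemma prob_selected_le:
  assumes I: "finite I" and g: "\<And>X. g X \<in> I"
    and [measurable]: "\<And>B. B \<in> I \<Longrightarrow> Measurable.pred T (\<lambda>X. g X = B)" "\<And>B. B \<in> I \<Longrightarrow> Measurable.pred T (bad B)"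
    and det: "determined_by J g" "\<And>B. B \<in> I \<Longrightarrow> determined_by K (bad B)" and JK: "J \<inter> K = {}"
    and le: "\<And>B. B \<in> I \<Longrightarrow> \<P>(X in T. bad B X) \<le> c"
  shows "\<P>(X in T. bad (g X) X) \<le> c"
proof -
  have "0 \<le> c" using le[of "g undefined"] g measure_nonneg[of T] by (meson order_trans)
  have "\<P>(X in T. bad (g X) X) = T.prob (\<Union>B\<in>I. {X \<in> space T. g X = B \<and> bad B X})"
    by (rule arg_cong[of _ _ T.prob]) (use g in auto)
  also have "\<dots> \<le> (\<Sum>B\<in>I. \<P>(X in T. g X = B \<and> bad B X))"
    by (rule T.finite_measure_subadditive_finite) (use I in auto)
  also have "\<dots> = (\<Sum>B\<in>I. \<P>(X in T. g X = B) * \<P>(X in T. bad B X))"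
    by (intro sum.cong refl prob_determined_by_Int[where I=J and J=K])
       (use det JK in \<open>auto simp: determined_by_def\<close>)
  also have "\<dots> \<le> (\<Sum>B\<in>I. \<P>(X in T. g X = B) * c)"
    by (intro sum_mono mult_left_mono le) auto
  also have "\<dots> = c * (\<Sum>B\<in>I. \<P>(X in T. g X = B))"
    by (simp add: sum_distrib_left mult.commute)
  also have "(\<Sum>B\<in>I. \<P>(X in T. g X = B)) = T.prob (\<Union>B\<in>I. {X \<in> space T. g X = B})"
    by (rule T.finite_measure_finite_Union[symmetric]) (use I in \<open>auto simp: disjoint_family_on_def\<close>)
  also have "c * \<dots> \<le> c * 1" using \<open>0 \<le> c\<close> by (intro mult_left_mono) auto
  finally show ?thesis by simp
qed

lemma pair_measurable [measurable]: "fst q \<in> S \<Longrightarrow> (\<lambda>X. pair X q) \<in> T \<rightarrow>\<^sub>M borel \<Otimes>\<^sub>M borel"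
  unfolding pair_def by simp

lemma distr_pair:
  assumes "fst q \<in> S"
  shows "distr T (borel \<Otimes>\<^sub>M borel) (\<lambda>X. pair X q) = D (fst q) \<Otimes>\<^sub>M D (fst q)"
proof -
  let ?a = "(fst q, 2 * snd q)" and ?b = "(fst q, 2 * snd q + 1)"
  have "T.indep_var (PiM {?a} (\<lambda>_. borel)) (\<lambda>X. \<lambda>p\<in>{?a}. X (fst p) (snd p))
      (PiM {?b} (\<lambda>_. borel)) (\<lambda>X. \<lambda>p\<in>{?b}. X (fst p) (snd p))"
    by (rule T.indep_var_restrict[OF indep_entries]) (use assms in auto)
  then have "T.indep_var borel ((\<lambda>w. w ?a) \<circ> (\<lambda>X. \<lambda>p\<in>{?a}. X (fst p) (snd p)))
      borel ((\<lambda>w. w ?b) \<circ> (\<lambda>X. \<lambda>p\<in>{?b}. X (fst p) (snd p)))"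
    by (rule T.indep_var_compose) (rule measurable_component_singleton, simp)+
  then have "T.indep_var borel (\<lambda>X. X (fst q) (2 * snd q)) borel (\<lambda>X. X (fst q) (2 * snd q + 1))"
    by (simp add: comp_def)
  then show ?thesis
    unfolding T.indep_var_distribution_eq pair_def using assms by (simp add: distr_entry)
qed

lemma indep_pairs: "T.indep_vars (\<lambda>_. borel \<Otimes>\<^sub>M borel) (\<lambda>q X. pair X q) (S \<times> UNIV)"
proof -
  define K where "K q = {(fst q, 2 * snd q), (fst q, 2 * snd q + 1)}" for q :: "nat \<times> nat"
  have "T.indep_vars (\<lambda>q. PiM (K q) (\<lambda>_. borel)) (\<lambda>q X. restrict (\<lambda>p. X (fst p) (snd p)) (K q)) (S \<times> UNIV)"
  proof (rule T.indep_vars_restrict[OF indep_entries])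
    show "disjoint_family_on K (S \<times> UNIV)"
      by (auto simp: disjoint_family_on_def K_def; presburger)
  qed (auto simp: K_def)
  from T.indep_vars_compose2[OF this, of "\<lambda>q w. (w (fst q, 2 * snd q), w (fst q, 2 * snd q + 1))"
      "\<lambda>_. borel \<Otimes>\<^sub>M borel"]
  show ?thesis by (simp add: K_def pair_def)
qed

text \<open>The pairs may belong to one arm or to many: the first case serves the scores, the second
  the sum of all variance estimates.\<close>

lemma chernoff:
  fixes g :: "nat \<Rightarrow> real \<times> real \<Rightarrow> real"
  assumes Q: "finite Q" "Q \<subseteq> S \<times> UNIV"
    and [measurable]: "\<And>i. i \<in> S \<Longrightarrow> g i \<in> borel_measurable (borel \<Otimes>\<^sub>M borel)"
    and int: "\<And>i. i \<in> S \<Longrightarrow> integrable (D i \<Otimes>\<^sub>M D i) (\<lambda>z. exp (g i z))"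
    and le: "\<And>i. i \<in> S \<Longrightarrow> (\<integral>z. exp (g i z) \<partial>(D i \<Otimes>\<^sub>M D i)) \<le> exp (b i)"
  shows "\<P>(X in T. a \<le> (\<Sum>q\<in>Q. g (fst q) (pair X q))) \<le> exp ((\<Sum>q\<in>Q. b (fst q)) - a)"
proof -
  define h where "h q X = exp (g (fst q) (pair X q))" for q X
  have h [measurable]: "h q \<in> borel_measurable T" if "fst q \<in> S" for q
    unfolding h_def using that by measurable
  have gm: "(\<lambda>z. exp (g (fst q) z)) \<in> borel_measurable (borel \<Otimes>\<^sub>M borel)" if "fst q \<in> S" for q
    using that by measurable
  have "T.indep_vars (\<lambda>_. borel) h Q"
    unfolding h_def
    by (rule T.indep_vars_compose2[OF T.indep_vars_subset[OF indep_pairs Q(2)], where Y="\<lambda>q z. exp (g (fst q) z)"])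
       (use gm Q in auto)
  moreover have int_h: "integrable T (h q)" and E_h: "(\<integral>X. h q X \<partial>T) \<le> exp (b (fst q))" if "q \<in> Q" for q
  proof -
    have q: "fst q \<in> S" using that Q by auto
    have i1: "integrable (distr T (borel \<Otimes>\<^sub>M borel) (\<lambda>X. pair X q)) (\<lambda>z. exp (g (fst q) z))"
      unfolding distr_pair[OF q] by (rule int[OF q])
    show "integrable T (h q)"
      unfolding h_def by (rule integrable_distr[OF _ i1]) (use q in measurable)
    have "(\<integral>X. h q X \<partial>T) = (\<integral>z. exp (g (fst q) z) \<partial>distr T (borel \<Otimes>\<^sub>M borel) (\<lambda>X. pair X q))"
      unfolding h_def by (rule integral_distr[symmetric]) (use q gm in auto)
    then show "(\<integral>X. h q X \<partial>T) \<le> exp (b (fst q))"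
      using le[OF q] unfolding distr_pair[OF q] by simp
  qed
  ultimately have int: "integrable T (\<lambda>X. \<Prod>q\<in>Q. h q X)"
    and E: "(\<integral>X. (\<Prod>q\<in>Q. h q X) \<partial>T) = (\<Prod>q\<in>Q. \<integral>X. h q X \<partial>T)"
    using Q(1) by (auto intro!: T.indep_vars_integrable T.indep_vars_lebesgue_integral)
  have "{X \<in> space T. a \<le> (\<Sum>q\<in>Q. g (fst q) (pair X q))} = {X \<in> space T. exp a \<le> (\<Prod>q\<in>Q. h q X)}"
    using Q(1) by (simp add: h_def flip: exp_sum)
  then have "\<P>(X in T. a \<le> (\<Sum>q\<in>Q. g (fst q) (pair X q))) = \<P>(X in T. exp a \<le> (\<Prod>q\<in>Q. h q X))" by simp
  also have "\<dots> \<le> (\<integral>X. (\<Prod>q\<in>Q. h q X) \<partial>T) / exp a"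
    by (rule integral_Markov_inequality_measure[where A="{}"]) (use int in \<open>auto simp: h_def intro!: prod_nonneg\<close>)
  also have "(\<integral>X. (\<Prod>q\<in>Q. h q X) \<partial>T) \<le> (\<Prod>q\<in>Q. exp (b (fst q)))"
    unfolding E
  proof (rule prod_mono, rule conjI)
    show "0 \<le> (\<integral>X. h q X \<partial>T)" for q by (simp add: h_def)
  qed (rule E_h)
  also have "\<dots> = exp (\<Sum>q\<in>Q. b (fst q))" using Q(1) by (simp add: exp_sum)
  finally show ?thesis by (simp add: exp_diff divide_right_mono)
qed

end

subsection \<open>Grouped median elimination\<close>

text \<open>The limit 81 is the inverse square of \<open>1 - 8/9\<close>. The ratio 8/9 is the
  growth 16/9 of the price of a round times the halving of the group.\<close>

lemma sum_arith_geom: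
  "(\<Sum>r<R. (8/9) ^ r * (real r + 1)) \<le> 81"
proof -
  have "(\<Sum>r<R. (8/9) ^ r * (real r + 1)) = 81 - (81 + 9 * real R) * (8/9) ^ R"
    by (induction R) (simp_all add: algebra_simps add_divide_distrib)
  also have "\<dots> \<le> 81" by simp
  finally show ?thesis .
qed

locale grouped_elimination =
  fixes S :: "nat set" and eps L :: real
  assumes finite_S: "finite S" and S_nonempty: "S \<noteq> {}"
    and eps_pos: "0 < eps" and eps_less_1: "eps < 1" and L_ge_1: "1 \<le> L"
begin

definition K :: nat where "K = nat \<lceil>log 2 (1 / eps)\<rceil>"

text \<open>\<open>2 ^ R\<close> exceeds \<open>card S\<close>, so every group shrinks to at most
  one arm. Surplus rounds are free: a lone arm draws no samples in them, and the failure
  probabilities are summable over all rounds.\<close>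

definition R :: nat where "R = card S"

text \<open>\<open>m\<close>, \<open>f\<close> and \<open>n\<close> count pairs of samples. The factors 3072 and 589824 make the failure exponents of the
  last comparison and of round \<open>r\<close> at least \<open>L\<close> and \<open>L * (r + 1)\<close>.\<close>

definition m :: nat where "m = nat \<lceil>L / eps\<rceil>"

text \<open>With \<open>v = 2 ^ k * eps\<close> this is \<open>eps / (32 * v)\<close>: a variance of
  at most \<open>8 * v\<close> costs at most \<open>eps / 4\<close>, and a penalty of at most
  \<open>eps / 2\<close> forces a variance of at most \<open>16 * v\<close>.\<close>

definition lam :: "nat \<Rightarrow> real" where "lam k = 1 / (32 * 2 ^ k)"

definition f :: "nat \<Rightarrow> nat" where "f k = nat \<lceil>3072 * (2 ^ k * (L / eps))\<rceil>"

text \<open>The total is at most \<open>eps / 4\<close>. Accuracy \<open>(3/4) ^ r\<close> costs a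
  factor \<open>(16/9) ^ r\<close> in samples, which grows more slowly than the group
  shrinks.\<close>

definition epsr :: "nat \<Rightarrow> real" where "epsr r = eps / 16 * (3/4) ^ r"

definition n :: "nat \<Rightarrow> nat \<Rightarrow> nat" where
  "n k r = nat \<lceil>589824 * ((2 ^ k * (L / eps)) * ((16/9) ^ r * (real r + 1)))\<rceil>"

text \<open>Layout of the pair indices at level \<open>k\<close>: variance estimate below
  \<open>m\<close>, last comparison below \<open>m + f k\<close>, then consecutive blocks for the
  rounds.\<close>

definition off :: "nat \<Rightarrow> nat \<Rightarrow> nat" where
  "off k r = m + f k + (\<Sum>r'<r. n k r')"

definition vhat :: "table \<Rightarrow> nat \<Rightarrow> real" where
  "vhat X i = (\<Sum>p<m. half_sq (pair X (i, p))) / real m"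

text \<open>At the cap \<open>K\<close> the level bounds the variance trivially, because \<open>1 \<le> 2 ^ K * eps\<close>.\<close>

definition lev :: "table \<Rightarrow> nat \<Rightarrow> nat" where
  "lev X i = (LEAST k. k = K \<or> vhat X i \<le> 2 ^ k * eps)"

definition score :: "nat \<Rightarrow> nat \<Rightarrow> nat \<Rightarrow> table \<Rightarrow> nat \<Rightarrow> real" where
  "score k a b X i =
     (\<Sum>p\<in>{a..<b}. fst (pair X (i, p)) - lam k * half_sq (pair X (i, p))) / real (b - a)"

primrec surv :: "table \<Rightarrow> nat \<Rightarrow> nat \<Rightarrow> nat set" where
  "surv X k 0 = {i\<in>S. lev X i = k}"
| "surv X k (Suc r) = top_half (surv X k r) (score k (off k r) (off k (Suc r)) X)"

text \<open>A lone survivor is kept by \<open>top_half\<close> whatever its score, so it need not be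
  sampled.\<close>

definition active :: "table \<Rightarrow> nat \<Rightarrow> nat \<Rightarrow> bool" where
  "active X i r \<longleftrightarrow> i \<in> surv X (lev X i) r \<and> 2 \<le> card (surv X (lev X i) r)"

definition demand :: "nat \<Rightarrow> table \<Rightarrow> nat \<Rightarrow> nat" where
  "demand s X i = (case s of 0 \<Rightarrow> 2 * m
     | Suc r \<Rightarrow> 2 * (m + f (lev X i) + (\<Sum>r'<r. if active X i r' then n (lev X i) r' else 0)))"

text \<open>The samples of the last comparison are drawn from all arms before the rounds, since otherwise their
  indices would depend on the number of rounds in which an arm was active.\<close>

definition final :: "table \<Rightarrow> nat \<Rightarrow> real" where
  "final X i = score (lev X i) m (m + f (lev X i)) X i"

definition winners :: "table \<Rightarrow> nat set" where
  "winners X = {i\<in>S. i \<in> surv X (lev X i) R}"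

definition out :: "table \<Rightarrow> nat" where
  "out X = (LEAST i. i \<in> winners X \<and> (\<forall>j\<in>winners X. final X j \<le> final X i))"

section \<open>Levels, sizes of the surviving groups, and the winners\<close>

lemma lev_le_K: "lev X i \<le> K"
  unfolding lev_def by (rule Least_le) simp

lemma lev_bounds: "lev X i = K \<or> vhat X i \<le> 2 ^ lev X i * eps"
  unfolding lev_def by (rule LeastI[of _ K]) simp

lemma vhat_nonneg: "0 \<le> vhat X i"
  unfolding vhat_def half_sq_def by (intro divide_nonneg_nonneg sum_nonneg) auto

text \<open>By minimality the preceding level fails, so the estimate exceeds half of
  \<open>2 ^ lev X i * eps\<close>; the summand \<open>eps\<close> covers level 0. This charges the
  cost of an arm to its estimate.\<close>

lemma two_pow_lev_le: "2 ^ lev X i * eps \<le> 2 * vhat X i + eps"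
proof (cases "lev X i")
  case 0
  then show ?thesis using vhat_nonneg by simp
next
  case (Suc k)
  then have "\<not> (k = K \<or> vhat X i \<le> 2 ^ k * eps)"
    using not_less_Least[of k "\<lambda>k. k = K \<or> vhat X i \<le> 2 ^ k * eps"] by (simp add: lev_def)
  with Suc show ?thesis using eps_pos by simp
qed

lemma two_pow_K: "1 \<le> 2 ^ K * eps"
proof -
  have "log 2 (1 / eps) \<le> real K" unfolding K_def by linarith
  then have "2 powr log 2 (1 / eps) \<le> 2 powr real K" by (rule powr_mono) simp
  moreover have "2 powr log 2 (1 / eps) = 1 / eps" by (rule powr_log_cancel) (use eps_pos in auto)
  moreover have "2 powr real K = (2 :: real) ^ K" by (rule powr_realpow) simp
  ultimately have "1 / eps \<le> 2 ^ K" by simp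
  then show ?thesis using eps_pos by (simp add: divide_le_eq)
qed

lemma surv_subset_Suc: "surv X k (Suc r) \<subseteq> surv X k r"
  by (simp add: top_half_subset)

lemma surv_antimono: "r \<le> r' \<Longrightarrow> surv X k r' \<subseteq> surv X k r"
  by (rule lift_Suc_antimono_le[of "\<lambda>r. surv X k r"]) (auto simp: surv_subset_Suc simp del: surv.simps)

lemma surv_D: "i \<in> surv X k r \<Longrightarrow> i \<in> S \<and> lev X i = k"
  using surv_antimono[of 0 r X k] by auto

lemma surv_subset: "surv X k r \<subseteq> S"
  using surv_D by blast

lemma finite_surv [simp]: "finite (surv X k r)"
  using finite_subset[OF surv_subset finite_S] .

lemma active_antimono: "active X i r \<Longrightarrow> r' \<le> r \<Longrightarrow> active X i r'"
  unfolding active_def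
  using surv_antimono[of r' r X "lev X i"] card_mono[OF finite_surv surv_antimono[of r' r X "lev X i"]] by auto

text \<open>The size minus one is at least halved in each round, despite the rounding up.\<close>

lemma card_surv: "(real (card (surv X k r)) - 1) * 2 ^ r \<le> real (card (surv X k 0)) - 1"
proof (induction r)
  case 0
  then show ?case by simp
next
  case (Suc r)
  have "real (card (surv X k (Suc r))) = real ((card (surv X k r) + 1) div 2)"
    by (simp add: card_top_half)
  also have "\<dots> \<le> real (card (surv X k r) + 1) / 2" 
  proof -
    have "2 * ((card (surv X k r) + 1) div 2) \<le> card (surv X k r) + 1" by simp
    then have "real (2 * ((card (surv X k r) + 1) div 2)) \<le> real (card (surv X k r) + 1)" by (rule of_nat_mono)
    then show ?thesis by simp
  qed
  finally have "(real (card (surv X k (Suc r))) - 1) * 2 ^ Suc r \<le> (real (card (surv X k r) + 1) / 2 - 1) * 2 ^ Suc r"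
    by (intro mult_right_mono) auto
  also have "\<dots> = (real (card (surv X k r)) - 1) * 2 ^ r" by (simp add: field_simps)
  finally show ?case using Suc by linarith
qed

text \<open>A size of at least 2 is at most twice the size minus one.\<close>

lemma card_surv_active:
  assumes "2 \<le> card (surv X k r)"
  shows "real (card (surv X k r)) \<le> 2 * real (card (surv X k 0)) / 2 ^ r"
proof -
  have "real (card (surv X k r)) * 2 ^ r \<le> (2 * (real (card (surv X k r)) - 1)) * 2 ^ r"
    using assms by (intro mult_right_mono) auto
  also have "\<dots> \<le> 2 * real (card (surv X k 0))" using card_surv[of X k r] by (simp add: algebra_simps)
  finally show ?thesis by (simp add: field_simps)
qed

lemma card_surv_R: "card (surv X k R) \<le> 1"
proof (rule ccontr)
  assume "\<not> ?thesis"
  then have "1 * 2 ^ R \<le> (real (card (surv X k R)) - 1) * 2 ^ R" by (intro mult_right_mono) auto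
  also have "\<dots> \<le> real (card (surv X k 0)) - 1" by (rule card_surv)
  also have "\<dots> < real R" unfolding R_def using card_mono[OF finite_S surv_subset, of X k 0] by simp
  finally show False using of_nat_less_two_power[of R, where 'a=real] by linarith
qed

lemma surv_nonempty: "surv X k 0 \<noteq> {} \<Longrightarrow> surv X k r \<noteq> {}"
proof (induction r)
  case (Suc r)
  then have "0 < card (surv X k r)" by (simp add: card_gt_0_iff)
  then have "0 < card (surv X k (Suc r))" by (simp add: card_top_half)
  then show ?case by (metis card.empty less_irrefl)
qed

lemma winners_nonempty: "winners X \<noteq> {}"
proof -
  obtain i where "i \<in> S" using S_nonempty by blast
  then have "i \<in> surv X (lev X i) 0" by simp
  then have "surv X (lev X i) 0 \<noteq> {}" by blast
  then have "surv X (lev X i) R \<noteq> {}" by (rule surv_nonempty)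
  then obtain j where j: "j \<in> surv X (lev X i) R" by blast
  with surv_D[OF j] have "j \<in> winners X" unfolding winners_def by simp
  then show ?thesis by blast
qed

lemma finite_winners: "finite (winners X)"
  using finite_S by (simp add: winners_def)

lemma out_winner: "out X \<in> winners X \<and> (\<forall>j\<in>winners X. final X j \<le> final X (out X))"
proof -
  have "Max (final X ` winners X) \<in> final X ` winners X"
    by (rule Max_in) (use finite_winners winners_nonempty in auto)
  then obtain i where i: "i \<in> winners X" "final X i = Max (final X ` winners X)" by auto
  then have "\<forall>j\<in>winners X. final X j \<le> final X i"
    using finite_winners by simp
  with i(1) have "\<exists>i. i \<in> winners X \<and> (\<forall>j\<in>winners X. final X j \<le> final X i)" by blast
  then show ?thesis unfolding out_def by (rule LeastI_ex)
qed

section \<open>Locality: choices depend only on samples already demanded\<close>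

lemma score_cong:
  assumes "\<And>n. 2 * a \<le> n \<Longrightarrow> n < 2 * b \<Longrightarrow> X i n = Y i n"
  shows "score k a b X i = score k a b Y i"
  unfolding score_def by (intro arg_cong2[of _ _ _ _ "(/)"] sum.cong refl) (auto simp: pair_def assms)

lemma lev_cong:
  assumes "\<And>n. n < 2 * m \<Longrightarrow> X i n = Y i n"
  shows "lev X i = lev Y i"
proof -
  have "vhat X i = vhat Y i"
    unfolding vhat_def by (intro arg_cong2[of _ _ _ _ "(/)"] sum.cong refl) (auto simp: pair_def assms)
  then show ?thesis by (simp add: lev_def)
qed

lemma lev_agree: "agree S (\<lambda>i. {..<demand s X i}) X Y \<Longrightarrow> i \<in> S \<Longrightarrow> lev X i = lev Y i"
  by (rule lev_cong) (auto simp: agree_def demand_def split: nat.splits)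

text \<open>An arm active in round \<open>r'\<close> was active in all earlier rounds, so no block
  was skipped and its cumulative demand reaches the end of the fixed block of that round.\<close>

lemma off_le_demand:
  assumes "active X i r'" "r' < r"
  shows "2 * off (lev X i) (Suc r') \<le> demand (Suc r) X i"
proof -
  have "(\<Sum>q<Suc r'. n (lev X i) q) = (\<Sum>q<Suc r'. if active X i q then n (lev X i) q else 0)"
    using active_antimono[OF assms(1)] by (intro sum.cong) auto
  also have "\<dots> \<le> (\<Sum>q<r. if active X i q then n (lev X i) q else 0)"
    using assms by (intro sum_mono2) auto
  finally show ?thesis by (simp add: off_def demand_def del: sum.lessThan_Suc)
qed

text \<open>Groups of at most one arm do not change whatever the scores are; in larger groups every
  arm is active, so the samples behind its score have been demanded.\<close>

lemma surv_agree:
  assumes "agree S (\<lambda>i. {..<demand (Suc r) X i}) X Y" "r' \<le> r"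
  shows "surv X k r' = surv Y k r'"
  using assms(2)
proof (induction r')
  case 0
  show ?case unfolding surv.simps by (rule Collect_cong) (metis lev_agree[OF assms(1)])
next
  case (Suc r')
  then have IH: "surv X k r' = surv Y k r'" by simp
  show ?case
  proof (cases "card (surv X k r') \<le> 1")
    case True
    then have "top_half (surv X k r') s = surv X k r'" for s by (rule top_half_small[OF finite_surv])
    then show ?thesis unfolding surv.simps IH[symmetric] by simp
  next
    case False
    have "score k (off k r') (off k (Suc r')) X i = score k (off k r') (off k (Suc r')) Y i"
      if i: "i \<in> surv X k r'" for i
    proof (rule score_cong)
      fix q assume "q < 2 * off k (Suc r')"
      moreover have l: "lev X i = k" and "i \<in> S" using surv_D[OF i] by auto
      moreover have "active X i r'" unfolding active_def l using False i by linarith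
      then have "2 * off k (Suc r') \<le> demand (Suc r) X i"
        using off_le_demand[of X i r' r] Suc.prems unfolding l by linarith
      ultimately show "X i q = Y i q" using assms(1) by (simp add: agree_def)
    qed
    then show ?thesis unfolding surv.simps IH[symmetric] by (rule top_half_cong)
  qed
qed

text \<open>Stage 0 serves the variance estimates, stage 1 adds the last comparison, and stage
  \<open>r + 2\<close> adds round \<open>r\<close>; hence the last stage is
  \<open>Suc R\<close>.\<close>

sublocale staged S "Suc R" demand out
proof
  show "finite S" by (rule finite_S)
  show "demand s X i \<le> demand (Suc s) X i" for s X i by (auto simp: demand_def split: nat.splits)
  show "demand 0 X i = demand 0 Y i" for X Y i by (simp add: demand_def)
  show "demand (Suc s) X i = demand (Suc s) Y i"
    if a: "agree S (\<lambda>i. {..<demand s X i}) X Y" and i: "i \<in> S" for s X Y i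
  proof (cases s)
    case 0
    then show ?thesis using lev_agree[OF a i] by (simp add: demand_def)
  next
    case (Suc r)
    have "active X i r' = active Y i r'" if "r' < Suc r" for r'
      unfolding active_def lev_agree[OF a i]
      using surv_agree[OF a[unfolded Suc], of r' "lev Y i"] that by simp
    then have "(\<Sum>r'<Suc r. if active X i r' then n (lev X i) r' else 0)
        = (\<Sum>r'<Suc r. if active Y i r' then n (lev Y i) r' else 0)"
      unfolding lev_agree[OF a i] by (intro sum.cong) auto
    then show ?thesis using lev_agree[OF a i] by (simp add: demand_def Suc del: sum.lessThan_Suc)
  qed
  show "out X = out Y" if a: "agree S (\<lambda>i. {..<demand (Suc R) X i}) X Y" for X Y
  proof -
    have w: "winners X = winners Y"
      unfolding winners_def using lev_agree[OF a] surv_agree[OF a, of R] by auto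
    have "final X i = final Y i" if "i \<in> S" for i
      unfolding final_def lev_agree[OF a that]
      by (rule score_cong) (use a that lev_agree[OF a that] in \<open>auto simp: agree_def demand_def\<close>)
    then have "(\<forall>j\<in>winners X. final X j \<le> final X i) = (\<forall>j\<in>winners X. final Y j \<le> final Y i)"
      if "i \<in> winners X" for i
      using that by (auto simp: winners_def)
    then show ?thesis unfolding out_def w by (metis (no_types, lifting))
  qed
qed

section \<open>Cost of the run in terms of the levels\<close>

lemma m_pos: "0 < m" and m_ge: "L \<le> real m * eps" and m_le: "real m \<le> 2 * (L / eps)"
proof -
  have "1 \<le> L / eps" using eps_pos eps_less_1 L_ge_1 by (simp add: divide_simps)
  then show "0 < m" "real m \<le> 2 * (L / eps)" unfolding m_def by linarith+
  have "L / eps \<le> real m" unfolding m_def by linarith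
  then show "L \<le> real m * eps" using eps_pos by (simp add: divide_simps)
qed

text \<open>Lets the rounding error of each ceiling be absorbed into the constant, whence 3073 and
  589825 below.\<close>

lemma L_div_eps: "1 \<le> 2 ^ k * (L / eps)"
proof -
  have "1 * 1 \<le> 2 ^ k * (L / eps)"
    using eps_pos eps_less_1 L_ge_1 by (intro mult_mono) (auto simp: divide_simps)
  then show ?thesis by simp
qed

lemma f_bounds: "3072 * (2 ^ k * (L / eps)) \<le> real (f k)" "real (f k) \<le> 3073 * (2 ^ k * (L / eps))"
proof -
  define a where "a = 2 ^ k * (L / eps)"
  have "1 \<le> a" "f k = nat \<lceil>3072 * a\<rceil>" using L_div_eps[of k] by (simp_all add: f_def a_def)
  then have "3072 * a \<le> real (f k)" "real (f k) \<le> 3073 * a" by linarith+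
  then show "3072 * (2 ^ k * (L / eps)) \<le> real (f k)" "real (f k) \<le> 3073 * (2 ^ k * (L / eps))"
    by (simp_all add: a_def)
qed

lemma n_bounds:
  "589824 * (2 ^ k * (L / eps)) * ((16/9) ^ r * (real r + 1)) \<le> real (n k r)"
  "real (n k r) \<le> 589825 * (2 ^ k * (L / eps)) * ((16/9) ^ r * (real r + 1))"
proof -
  define a where "a = (2 ^ k * (L / eps)) * ((16/9) ^ r * (real r + 1))"
  have "1 * 1 \<le> (16/9) ^ r * (real r + 1)" by (intro mult_mono) auto
  then have "1 * 1 \<le> a" unfolding a_def using L_div_eps[of k] by (intro mult_mono) auto
  moreover have "n k r = nat \<lceil>589824 * a\<rceil>" by (simp add: n_def a_def)
  ultimately have "589824 * a \<le> real (n k r)" "real (n k r) \<le> 589825 * a" by linarith+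
  then show "589824 * (2 ^ k * (L / eps)) * ((16/9) ^ r * (real r + 1)) \<le> real (n k r)"
    "real (n k r) \<le> 589825 * (2 ^ k * (L / eps)) * ((16/9) ^ r * (real r + 1))"
    by (simp_all add: a_def mult.assoc)
qed

text \<open>Exchanging the sums, round \<open>r\<close> involves at most a \<open>2 / 2 ^ r\<close>
  fraction of the group at price \<open>(16/9) ^ r * (r + 1)\<close>, a convergent series. The
  constant is \<open>2 * 589825 * 81\<close>.\<close>

lemma elimination_cost:
  "(\<Sum>i\<in>surv X k 0. \<Sum>r<R. if active X i r then real (n k r) else 0)
     \<le> real (card (surv X k 0)) * (95551650 * (2 ^ k * (L / eps)))"
proof -
  let ?c = "real (card (surv X k 0))"
  have "(\<Sum>i\<in>surv X k 0. \<Sum>r<R. if active X i r then real (n k r) else 0)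
      = (\<Sum>r<R. \<Sum>i\<in>surv X k 0. if active X i r then real (n k r) else 0)"
    by (rule sum.swap)
  also have "\<dots> \<le> (\<Sum>r<R. 2 * ?c / 2 ^ r * real (n k r))"
  proof (rule sum_mono)
    fix r
    have "(\<Sum>i\<in>surv X k 0. if active X i r then real (n k r) else 0)
        = real (card {i\<in>surv X k 0. active X i r}) * real (n k r)"
      by (subst sum.inter_filter[symmetric]) (auto simp: finite_S)
    also have "\<dots> \<le> 2 * ?c / 2 ^ r * real (n k r)"
    proof (cases "2 \<le> card (surv X k r)")
      case True
      have "{i\<in>surv X k 0. active X i r} \<subseteq> surv X k r" by (auto simp: active_def)
      then have "real (card {i\<in>surv X k 0. active X i r}) \<le> real (card (surv X k r))"
        by (simp add: card_mono)
      also have "\<dots> \<le> 2 * ?c / 2 ^ r" by (rule card_surv_active[OF True])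
      finally show ?thesis by (intro mult_right_mono) auto
    next
      case False
      then have none: "{i\<in>surv X k 0. active X i r} = {}" by (auto simp: active_def)
      show ?thesis unfolding none by simp
    qed
    finally show "(\<Sum>i\<in>surv X k 0. if active X i r then real (n k r) else 0) \<le> 2 * ?c / 2 ^ r * real (n k r)" .
  qed
  also have "\<dots> \<le> (\<Sum>r<R. 2 * ?c / 2 ^ r * (589825 * (2 ^ k * (L / eps)) * ((16/9) ^ r * (real r + 1))))"
    by (intro sum_mono mult_left_mono n_bounds) auto
  also have "\<dots> = ?c * (1179650 * (2 ^ k * (L / eps))) * (\<Sum>r<R. (8/9) ^ r * (real r + 1))"
    unfolding sum_distrib_left
  proof (intro sum.cong refl)
    fix r
    have "(8/9 :: real) ^ r = (16/9) ^ r / 2 ^ r" by (simp flip: power_divide)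
    then show "2 * ?c / 2 ^ r * (589825 * (2 ^ k * (L / eps)) * ((16/9) ^ r * (real r + 1)))
        = ?c * (1179650 * (2 ^ k * (L / eps))) * ((8/9) ^ r * (real r + 1))"
      by (simp add: mult_ac del: surv.simps)
  qed
  also have "\<dots> \<le> ?c * (1179650 * (2 ^ k * (L / eps))) * 81"
    by (intro mult_left_mono sum_arith_geom mult_nonneg_nonneg) (use L_ge_1 eps_pos in auto)
  finally show ?thesis by (simp add: mult_ac del: surv.simps)
qed

lemma demand_le:
  "real (\<Sum>i\<in>S. demand (Suc R) X i) \<le> 2 * 10 ^ 8 * (L / eps) * (\<Sum>i\<in>S. 2 ^ lev X i)"
proof -
  define el where "el i = (\<Sum>r<R. if active X i r then real (n (lev X i) r) else 0)" for i
  have "(\<Sum>i\<in>S. el i) = (\<Sum>k\<le>K. \<Sum>i\<in>{i\<in>S. lev X i = k}. el i)"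
    by (rule sum.group[symmetric]) (use finite_S lev_le_K in auto)
  also have "\<dots> \<le> (\<Sum>k\<le>K. \<Sum>i\<in>{i\<in>S. lev X i = k}. 95551650 * (2 ^ lev X i * (L / eps)))"
  proof (rule sum_mono)
    fix k
    have "(\<Sum>i\<in>{i\<in>S. lev X i = k}. el i) = (\<Sum>i\<in>surv X k 0. \<Sum>r<R. if active X i r then real (n k r) else 0)"
      by (intro sum.cong) (auto simp: el_def)
    also have "\<dots> \<le> real (card (surv X k 0)) * (95551650 * (2 ^ k * (L / eps)))" by (rule elimination_cost)
    also have "\<dots> = (\<Sum>i\<in>{i\<in>S. lev X i = k}. 95551650 * (2 ^ lev X i * (L / eps)))" by simp
    finally show "(\<Sum>i\<in>{i\<in>S. lev X i = k}. el i) \<le> (\<Sum>i\<in>{i\<in>S. lev X i = k}. 95551650 * (2 ^ lev X i * (L / eps)))" .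
  qed
  also have "\<dots> = (\<Sum>i\<in>S. 95551650 * (2 ^ lev X i * (L / eps)))"
    by (rule sum.group) (use finite_S lev_le_K in auto)
  also have "\<dots> = 95551650 * (\<Sum>i\<in>S. 2 ^ lev X i * (L / eps))"
    by (simp only: sum_distrib_left)
  finally have el: "(\<Sum>i\<in>S. el i) \<le> 95551650 * (\<Sum>i\<in>S. 2 ^ lev X i * (L / eps))" .
  have "real (demand (Suc R) X i) \<le> 2 * (3075 * (2 ^ lev X i * (L / eps)) + el i)" if "i \<in> S" for i
  proof -
    define a where "a = 2 ^ lev X i * (L / eps)"
    have "real (demand (Suc R) X i) = 2 * (real m + real (f (lev X i)) + el i)"
      by (simp add: demand_def el_def if_distrib[of real] cong: if_cong)
    moreover have "1 * (L / eps) \<le> a"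
      unfolding a_def using L_ge_1 eps_pos by (intro mult_right_mono) auto
    then have "real m \<le> 2 * a" using m_le by linarith
    moreover have "real (f (lev X i)) \<le> 3073 * a" unfolding a_def by (rule f_bounds)
    ultimately have "real (demand (Suc R) X i) \<le> 2 * (2 * a + 3073 * a + el i)" by auto
    also have "2 * a + 3073 * a = 3075 * a" by simp
    finally show ?thesis unfolding a_def by simp
  qed
  then have "real (\<Sum>i\<in>S. demand (Suc R) X i) \<le> (\<Sum>i\<in>S. 2 * (3075 * (2 ^ lev X i * (L / eps)) + el i))"
    unfolding of_nat_sum by (intro sum_mono) auto
  also have "\<dots> = 6150 * (\<Sum>i\<in>S. 2 ^ lev X i * (L / eps)) + 2 * (\<Sum>i\<in>S. el i)"
    by (simp only: distrib_left sum.distrib sum_distrib_left[symmetric])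
  also have "\<dots> \<le> 6150 * (\<Sum>i\<in>S. 2 ^ lev X i * (L / eps)) + 2 * (95551650 * (\<Sum>i\<in>S. 2 ^ lev X i * (L / eps)))"
    by (intro add_left_mono mult_left_mono el) simp
  \<comment> \<open>The exact coefficient is \<open>6150 + 2 * 95551650 = 191109450\<close>.\<close>
  also have "\<dots> \<le> 2 * 10 ^ 8 * (\<Sum>i\<in>S. 2 ^ lev X i * (L / eps))"
  proof -
    have "0 \<le> (\<Sum>i\<in>S. 2 ^ lev X i * (L / eps))" using L_ge_1 eps_pos by (intro sum_nonneg) auto
    then show ?thesis by simp
  qed
  also have "(\<Sum>i\<in>S. 2 ^ lev X i * (L / eps)) = (\<Sum>i\<in>S. 2 ^ lev X i) * (L / eps)"
    by (rule sum_distrib_right[symmetric])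
  finally show ?thesis by (simp only: mult_ac)
qed

end

subsection \<open>Failure probabilities\<close>

text \<open>Markov's inequality for the number of events that occur. It stands in for a union bound
  over arms and assumes no independence.\<close>

lemma (in prob_space) prob_card_ge:
  fixes A :: "'i \<Rightarrow> 'a \<Rightarrow> bool" and c :: nat
  assumes W: "finite W" and [measurable]: "\<And>j. j \<in> W \<Longrightarrow> Measurable.pred M (A j)"
    and le: "\<And>j. j \<in> W \<Longrightarrow> \<P>(x in M. A j x) \<le> p" and c: "0 < c"
  shows "\<P>(x in M. c \<le> card {j\<in>W. A j x}) \<le> real (card W) * p / real c"
proof -
  define u where "u x = (\<Sum>j\<in>W. indicator {x\<in>space M. A j x} x :: real)" for x
  have int: "integrable M (indicator {x\<in>space M. A j x} :: 'a \<Rightarrow> real)" if "j \<in> W" for j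
    by (rule integrable_real_indicator) (use that in \<open>simp_all add: emeasure_eq_measure\<close>)
  have u: "u x = real (card {j\<in>W. A j x})" if "x \<in> space M" for x
  proof -
    have "u x = (\<Sum>j\<in>W. if A j x then 1 else 0)" unfolding u_def by (intro sum.cong) (use that in auto)
    also have "\<dots> = (\<Sum>j\<in>{j\<in>W. A j x}. 1)" by (rule sum.inter_filter[OF W, symmetric])
    also have "\<dots> = real (card {j\<in>W. A j x})" by simp
    finally show ?thesis .
  qed
  have "\<P>(x in M. c \<le> card {j\<in>W. A j x}) = \<P>(x in M. real c \<le> u x)"
    by (intro arg_cong[of _ _ prob] Collect_cong conj_cong refl) (simp add: u)
  also have "\<dots> \<le> (\<integral>x. u x \<partial>M) / real c"
    by (rule integral_Markov_inequality_measure[where A="{}"])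
       (use int c in \<open>auto simp: u_def intro!: sum_nonneg\<close>)
  also have "(\<integral>x. u x \<partial>M) = (\<Sum>j\<in>W. \<P>(x in M. A j x))"
    unfolding u_def by (subst Bochner_Integration.integral_sum) (use int in auto)
  also have "\<dots> \<le> real (card W) * p" using sum_bounded_above[of W "\<lambda>j. \<P>(x in M. A j x)" p] le by simp
  finally show ?thesis by (simp add: divide_right_mono)
qed

lemma pred_and_const: "Measurable.pred M P \<Longrightarrow> Measurable.pred M (\<lambda>x. P x \<and> c)"
  by (cases c) simp_all

lemma pred_real:
  fixes g h :: "'a \<Rightarrow> real"
  assumes [measurable]: "g \<in> borel_measurable M" "h \<in> borel_measurable M"
  shows pred_le_real: "Measurable.pred M (\<lambda>x. g x \<le> h x)"
    and pred_less_real: "Measurable.pred M (\<lambda>x. g x < h x)"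
    and pred_eq_real: "Measurable.pred M (\<lambda>x. g x = h x)"
  by measurable

lemma sum_singleton_Times: "(\<Sum>p\<in>{i} \<times> A. h p) = (\<Sum>x\<in>A. h (i, x))"
  using sum.cartesian_product[of "\<lambda>i x. h (i, x)" A "{i}"] by simp

locale elimination_run = arms S D + grouped_elimination S eps L for S D eps L
begin

definition top :: real where "top = Max ((\<lambda>i. mean_of (D i)) ` S)"

definition q :: "nat \<Rightarrow> nat \<Rightarrow> real" where "q k i = mean_of (D i) - lam k * var_of (D i)"

lemma mean_le_top: "i \<in> S \<Longrightarrow> mean_of (D i) \<le> top"
  unfolding top_def by (rule Max_ge) (use finite_S in auto)

lemma lam_bounds: "0 < lam k" "lam k \<le> 1 / 32"
  unfolding lam_def by (auto simp: divide_simps)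

section \<open>Measurability of the choices made by the algorithm\<close>

lemma vhat_measurable [measurable]: "i \<in> S \<Longrightarrow> (\<lambda>X. vhat X i) \<in> borel_measurable T"
  unfolding vhat_def by measurable

lemma lev_measurable [measurable]: "i \<in> S \<Longrightarrow> (\<lambda>X. lev X i) \<in> T \<rightarrow>\<^sub>M count_space UNIV"
  unfolding lev_def by measurable

lemma score_measurable [measurable]: "i \<in> S \<Longrightarrow> (\<lambda>X. score k a b X i) \<in> borel_measurable T"
  unfolding score_def by measurable

lemma top_half_eq_measurable:
  assumes "B \<subseteq> S"
  shows "Measurable.pred T (\<lambda>X. top_half B (score k a b X) = C)"
proof -
  have fin: "finite B" using assms finite_S finite_subset by blast
  have beats: "Measurable.pred T (\<lambda>X. beats (score k a b X) j i)" if "i \<in> B" "j \<in> B" for i j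
  proof -
    have [measurable]: "(\<lambda>X. score k a b X i) \<in> borel_measurable T" "(\<lambda>X. score k a b X j) \<in> borel_measurable T"
      using that assms by (auto intro: score_measurable)
    show ?thesis unfolding beats_def
      by (intro pred_intros_logic pred_less_real pred_eq_real pred_and_const) fact+
  qed
  \<comment> \<open>Rewrites a cardinality condition as a finite disjunction over the possible sets
    \<open>W\<close> of arms ranked ahead of \<open>i\<close>.\<close>
  have rank_eq: "rank B s i < c \<longleftrightarrow> (\<exists>W\<in>Pow B. (\<forall>j\<in>B. beats s j i \<longleftrightarrow> j \<in> W) \<and> card W < c)" for s i c
  proof
    assume "rank B s i < c"
    then show "\<exists>W\<in>Pow B. (\<forall>j\<in>B. beats s j i \<longleftrightarrow> j \<in> W) \<and> card W < c"
      by (intro bexI[of _ "{j\<in>B. beats s j i}"]) (auto simp: rank_def)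
  next
    assume "\<exists>W\<in>Pow B. (\<forall>j\<in>B. beats s j i \<longleftrightarrow> j \<in> W) \<and> card W < c"
    then obtain W where W: "W \<subseteq> B" "\<forall>j\<in>B. beats s j i \<longleftrightarrow> j \<in> W" "card W < c" by blast
    then have "{j\<in>B. beats s j i} = W" by blast
    with W show "rank B s i < c" by (simp add: rank_def)
  qed
  have rank: "Measurable.pred T (\<lambda>X. rank B (score k a b X) i < c)" if "i \<in> B" for i c
    unfolding rank_eq
    by (intro pred_intros_finite(4) pred_intros_finite(3) pred_intros_logic beats that) (use fin in auto)
  have "top_half B s = C \<longleftrightarrow> C \<subseteq> B \<and> (\<forall>i\<in>B. rank B s i < (card B + 1) div 2 \<longleftrightarrow> i \<in> C)" for s
    unfolding top_half_def by blast
  then show ?thesis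
    by (simp only:) (intro pred_intros_logic pred_intros_finite(3) rank fin; simp)
qed

lemma surv_eq_measurable [measurable]: "Measurable.pred T (\<lambda>X. surv X k r = C)"
proof (induction r arbitrary: C)
  case 0
  have "surv X k 0 = C \<longleftrightarrow> C \<subseteq> S \<and> (\<forall>i\<in>S. lev X i = k \<longleftrightarrow> i \<in> C)" for X by auto
  moreover have "Measurable.pred T (\<lambda>X. lev X i = k)" if "i \<in> S" for i using that by measurable
  ultimately show ?case using finite_S by (simp del: surv.simps)
next
  case (Suc r)
  have "surv X k (Suc r) = C \<longleftrightarrow>
      (\<exists>B\<in>Pow S. surv X k r = B \<and> top_half B (score k (off k r) (off k (Suc r)) X) = C)" for X
    using surv_subset[of X k r] by auto
  moreover have "Measurable.pred T (\<lambda>X. \<exists>B\<in>Pow S. surv X k r = B \<and> top_half B (score k (off k r) (off k (Suc r)) X) = C)"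
    using finite_S Suc top_half_eq_measurable
    by (intro pred_intros_finite pred_intros_logic) auto
  ultimately show ?case by (simp only:)
qed

text \<open>\<open>surv\<close> takes values among the finitely many subsets of \<open>S\<close>, so
  a condition on it is a finite disjunction.\<close>

lemma surv_measurable:
  assumes "\<And>B. B \<subseteq> S \<Longrightarrow> Measurable.pred T (P B)"
  shows "Measurable.pred T (\<lambda>X. P (surv X k r) X)"
proof -
  have "P (surv X k r) X \<longleftrightarrow> (\<exists>B\<in>Pow S. surv X k r = B \<and> P B X)" for X
    using surv_subset[of X k r] by auto
  moreover have "Measurable.pred T (\<lambda>X. \<exists>B\<in>Pow S. surv X k r = B \<and> P B X)"
    using finite_S assms by (intro pred_intros_finite pred_intros_logic) auto
  ultimately show ?thesis by (simp only:)
qed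

lemma mem_surv_measurable [measurable]: "Measurable.pred T (\<lambda>X. i \<in> surv X k r)"
  by (rule surv_measurable) simp

lemma active_measurable [measurable]: "i \<in> S \<Longrightarrow> Measurable.pred T (\<lambda>X. active X i r)"
proof -
  assume i: "i \<in> S"
  have "Measurable.pred T (\<lambda>X. i \<in> surv X k r \<and> 2 \<le> card (surv X k r))" for k
    by (rule surv_measurable[where P="\<lambda>B X. i \<in> B \<and> 2 \<le> card B"]) simp
  then show ?thesis
    unfolding active_def by (rule measurable_compose_countable[OF _ lev_measurable[OF i]])
qed

lemma demand_measurable [measurable]:
  assumes i: "i \<in> S"
  shows "(\<lambda>X. demand s X i) \<in> T \<rightarrow>\<^sub>M count_space UNIV"
proof (cases s)
  case (Suc r)
  have "(\<lambda>X. 2 * (m + f k + (\<Sum>r'<r. if active X i r' then n k r' else 0))) \<in> T \<rightarrow>\<^sub>M count_space UNIV" for k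
    using i by measurable
  then show ?thesis
    unfolding demand_def Suc nat.case by (rule measurable_compose_countable[OF _ lev_measurable[OF i]])
qed (simp add: demand_def)

lemma final_measurable [measurable]: 
  assumes i: "i \<in> S"
  shows "(\<lambda>X. final X i) \<in> borel_measurable T"
  unfolding final_def
  by (rule measurable_compose_countable[OF score_measurable[OF i] lev_measurable[OF i]])

lemma winners_measurable [measurable]: 
  assumes i: "i \<in> S"
  shows "Measurable.pred T (\<lambda>X. i \<in> winners X)"
proof -
  have "Measurable.pred T (\<lambda>X. i \<in> surv X (lev X i) R)"
    by (rule measurable_compose_countable[OF mem_surv_measurable lev_measurable[OF i]])
  then show ?thesis using i by (simp add: winners_def)
qed

lemma out_measurable [measurable]: "out \<in> T \<rightarrow>\<^sub>M count_space UNIV"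
proof -
  have "(\<lambda>X. LEAST i. i \<in> winners X \<and> (\<forall>j\<in>winners X. final X j \<le> final X i)) \<in> T \<rightarrow>\<^sub>M count_space UNIV"
  proof (rule measurable_Least)
    fix i
    show "Measurable.pred T (\<lambda>X. i \<in> winners X \<and> (\<forall>j\<in>winners X. final X j \<le> final X i))"
    proof (cases "i \<in> S")
      case True
      have "(i \<in> winners X \<and> (\<forall>j\<in>winners X. final X j \<le> final X i)) \<longleftrightarrow>
          (i \<in> winners X \<and> (\<forall>j\<in>S. j \<in> winners X \<longrightarrow> final X j \<le> final X i))" for X
        by (auto simp: winners_def)
      moreover have "Measurable.pred T (\<lambda>X. i \<in> winners X \<and> (\<forall>j\<in>S. j \<in> winners X \<longrightarrow> final X j \<le> final X i))"
        using True finite_S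
        by (intro pred_intros_logic pred_intros_finite winners_measurable pred_le_real final_measurable) auto
      ultimately show ?thesis by (simp only:)
    next
      case False
      then show ?thesis by (simp add: winners_def)
    qed
  qed
  then show ?thesis by (simp add: out_def[abs_def])
qed

section \<open>Sample indices that determine survivors and scores\<close>

lemma lev_determined: "i \<in> S \<Longrightarrow> agree S (\<lambda>_. {..<2 * m}) X Y \<Longrightarrow> lev X i = lev Y i"
  by (rule lev_cong) (auto simp: agree_def)

lemma off_mono: "r \<le> r' \<Longrightarrow> off k r \<le> off k r'"
  unfolding off_def by (intro add_left_mono sum_mono2) auto

text \<open>The index set leaves out the block from \<open>2 * m\<close> to
  \<open>2 * off k 0\<close> of the last comparison, so the survivors are independent both of the
  next round and of the final scores.\<close>

lemma surv_determined:
  "determined_by ({..<2 * m} \<union> {2 * off k 0..<2 * off k r}) (\<lambda>X. surv X k r)"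
proof (induction r)
  case 0
  show ?case unfolding determined_by_def surv.simps
    by (safe intro!: Collect_cong; metis lev_determined agree_mono Un_upper1)
next
  case (Suc r)
  show ?case unfolding determined_by_def
  proof (intro allI impI)
    fix X Y assume a: "agree S (\<lambda>_. {..<2 * m} \<union> {2 * off k 0..<2 * off k (Suc r)}) X Y"
    have "agree S (\<lambda>_. {..<2 * m} \<union> {2 * off k 0..<2 * off k r}) X Y"
      by (rule agree_mono[OF a]) (use off_mono[of r "Suc r" k] in auto)
    then have IH: "surv X k r = surv Y k r" using Suc unfolding determined_by_def by blast
    have "score k (off k r) (off k (Suc r)) X i = score k (off k r) (off k (Suc r)) Y i"
      if "i \<in> surv X k r" for i
      by (rule score_cong) (use a that surv_D[OF that] off_mono[of 0 r k] in \<open>auto simp: agree_def\<close>)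
    then show "surv X k (Suc r) = surv Y k (Suc r)"
      unfolding surv.simps IH[symmetric] by (rule top_half_cong)
  qed
qed

lemma score_determined:
  "i \<in> S \<Longrightarrow> agree S (\<lambda>_. {2 * a..<2 * b}) X Y \<Longrightarrow> score k a b X i = score k a b Y i"
  by (rule score_cong) (auto simp: agree_def)

section \<open>Tail bounds for the scores, and failure of a round or of the last comparison\<close>

lemma score_tail:
  assumes i: "i \<in> S" and ab: "a < b" and s: "\<bar>s\<bar> \<le> 1/2"
    and e: "x \<le> real (b - a) * (s * c - s * q k i - 3 * s\<^sup>2 * var_of (D i))"
  shows "\<P>(X in T. s * c \<le> s * score k a b X i) \<le> exp (- x)"
proof -
  define g where "g = (\<lambda>(_::nat) z. s * (fst z - lam k * half_sq z))"
  have "s * c \<le> s * score k a b X i \<longleftrightarrow>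
      real (b - a) * (s * c) \<le> (\<Sum>p\<in>{i} \<times> {a..<b}. g (fst p) (pair X p))" for X
  proof -
    have "(\<Sum>p\<in>{i} \<times> {a..<b}. g (fst p) (pair X p)) = (\<Sum>p\<in>{a..<b}. s * (fst (pair X (i, p)) - lam k * half_sq (pair X (i, p))))"
      by (simp add: g_def sum_singleton_Times)
    also have "\<dots> = real (b - a) * (s * score k a b X i)"
      unfolding score_def sum_distrib_left[symmetric] using ab by simp
    finally show ?thesis using ab by simp
  qed
  then have "\<P>(X in T. s * c \<le> s * score k a b X i)
      = \<P>(X in T. real (b - a) * (s * c) \<le> (\<Sum>p\<in>{i} \<times> {a..<b}. g (fst p) (pair X p)))" by simp
  also have "\<dots> \<le> exp ((\<Sum>p\<in>{i} \<times> {a..<b}. s * q k (fst p) + 3 * s\<^sup>2 * var_of (D (fst p))) - real (b - a) * (s * c))"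
  proof (rule chernoff)
    fix j
    show "g j \<in> borel_measurable (borel \<Otimes>\<^sub>M borel)" unfolding g_def by measurable
    show "(\<integral>z. exp (g j z) \<partial>(D j \<Otimes>\<^sub>M D j)) \<le> exp (s * q k j + 3 * s\<^sup>2 * var_of (D j))"
      unfolding g_def q_def by (rule arm.exp_penalized_le) (use lam_bounds[of k] s in auto)
    show "integrable (D j \<Otimes>\<^sub>M D j) (\<lambda>z. exp (g j z))"
    proof (rule arm.integrable_exp_DD[where B=1])
      fix x y :: real assume xy: "0 \<le> x" "x \<le> 1" "0 \<le> y" "y \<le> 1"
      have "0 \<le> lam k * half_sq (x, y)" "lam k * half_sq (x, y) \<le> 1 * 1"
        using half_sq_bounds[OF xy] lam_bounds[of k] by (simp, intro mult_mono) auto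
      then have "\<bar>x - lam k * half_sq (x, y)\<bar> \<le> 1" using xy by auto
      then have "\<bar>s * (x - lam k * half_sq (x, y))\<bar> \<le> 1/2 * 1"
        unfolding abs_mult using s by (intro mult_mono) auto
      then show "g j (x, y) \<le> 1" by (simp add: g_def)
    qed (simp add: g_def)
  qed (use i in auto)
  also have "(\<Sum>p\<in>{i} \<times> {a..<b}. s * q k (fst p) + 3 * s\<^sup>2 * var_of (D (fst p))) - real (b - a) * (s * c)
      = - (real (b - a) * (s * c - s * q k i - 3 * s\<^sup>2 * var_of (D i)))"
    by (simp add: sum_singleton_Times algebra_simps)
  also have "exp \<dots> \<le> exp (- x)" using e by simp
  finally show ?thesis .
qed

lemma variance_of_good_arm:
  assumes "i \<in> S" "top - eps / 2 \<le> q k i"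
  shows "var_of (D i) \<le> 16 * (2 ^ k * eps)"
proof -
  have "lam k * var_of (D i) \<le> eps / 2" using assms mean_le_top[OF assms(1)] by (simp add: q_def)
  then show ?thesis by (simp add: lam_def field_simps)
qed

text \<open>The guard \<open>top - eps / 2\<close> ensures that the best arm of \<open>B\<close> has
  variance of order \<open>2 ^ k * eps\<close>, so its score is reliable; along a good run the guard
  persists because the losses add up to at most \<open>eps / 2\<close>.\<close>

definition bad_round :: "nat \<Rightarrow> nat \<Rightarrow> nat set \<Rightarrow> table \<Rightarrow> bool" where
  "bad_round k r B X \<longleftrightarrow> B \<noteq> {} \<and> top - eps / 2 \<le> Max (q k ` B) \<and>
     (\<forall>j\<in>top_half B (score k (off k r) (off k (Suc r)) X). q k j < Max (q k ` B) - epsr r)"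

text \<open>Overshooting is measured from the mean instead of \<open>q\<close>: the penalty is the
  slack that covers an arm of any variance. Undershooting concerns only near-optimal arms, whose
  variance is controlled.\<close>

definition bad_final :: "nat \<Rightarrow> nat set \<Rightarrow> table \<Rightarrow> bool" where
  "bad_final k B X \<longleftrightarrow> card B \<le> 1 \<and> (\<exists>j\<in>B.
     mean_of (D j) + eps / 4 \<le> score k m (m + f k) X j \<or>
     top - eps / 2 \<le> q k j \<and> score k m (m + f k) X j \<le> q k j - eps / 4)"

lemma bad_round_measurable [measurable]: "B \<subseteq> S \<Longrightarrow> Measurable.pred T (bad_round k r B)"
proof -
  assume B: "B \<subseteq> S"
  let ?Q = "\<lambda>C. B \<noteq> {} \<and> top - eps / 2 \<le> Max (q k ` B) \<and> (\<forall>j\<in>C. q k j < Max (q k ` B) - epsr r)"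
  have "bad_round k r B = (\<lambda>X. \<exists>C\<in>Pow S. top_half B (score k (off k r) (off k (Suc r)) X) = C \<and> ?Q C)"
    unfolding bad_round_def using top_half_subset B by (intro ext) blast
  moreover have "Measurable.pred T (\<lambda>X. \<exists>C\<in>Pow S. top_half B (score k (off k r) (off k (Suc r)) X) = C \<and> ?Q C)"
    using finite_S top_half_eq_measurable[OF B]
    by (intro pred_intros_finite(4) pred_and_const) auto
  ultimately show ?thesis by (simp only:)
qed

lemma bad_final_measurable [measurable]: "B \<subseteq> S \<Longrightarrow> Measurable.pred T (bad_final k B)"
proof -
  assume B: "B \<subseteq> S"
  then have fin: "finite B" using finite_S finite_subset by blast
  have "Measurable.pred T (\<lambda>X. mean_of (D j) + eps / 4 \<le> score k m (m + f k) X j \<or>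
     top - eps / 2 \<le> q k j \<and> score k m (m + f k) X j \<le> q k j - eps / 4)" if "j \<in> B" for j
  proof -
    have [measurable]: "(\<lambda>X. score k m (m + f k) X j) \<in> borel_measurable T"
      by (rule score_measurable) (use that B in auto)
    show ?thesis by (intro pred_intros_logic(3,5) pred_le_real) simp_all
  qed
  then have "Measurable.pred T (\<lambda>X. \<exists>j\<in>B. mean_of (D j) + eps / 4 \<le> score k m (m + f k) X j \<or>
     top - eps / 2 \<le> q k j \<and> score k m (m + f k) X j \<le> q k j - eps / 4)"
    by (rule pred_intros_finite(4)[OF fin])
  then show ?thesis unfolding bad_final_def[abs_def] by (cases "card B \<le> 1") simp_all
qed

lemma epsr_bounds: "0 < epsr r" "epsr r \<le> eps / 16"
  using eps_pos by (auto simp: epsr_def power_le_one)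

lemma sum_epsr: "(\<Sum>r'<r. epsr r') \<le> eps / 4"
proof -
  have "(\<Sum>r'<r. epsr r') = eps / 4 - eps / 4 * (3/4) ^ r"
    by (induction r) (simp_all add: epsr_def)
  then show ?thesis using eps_pos by simp
qed

lemma block_length: "off k (Suc r) - off k r = n k r" "off k r < off k (Suc r)"
proof -
  have "1 \<le> (16/9 :: real) ^ r * (real r + 1)" 
    using mult_mono[of 1 "(16/9 :: real) ^ r" 1 "real r + 1"] by simp
  then have "0 < 589824 * (2 ^ k * (L / eps)) * ((16/9) ^ r * (real r + 1))"
    using L_ge_1 eps_pos by (intro mult_pos_pos) auto
  then have "0 < real (n k r)" using n_bounds(1)[of k r] by linarith
  then show "off k (Suc r) - off k r = n k r" "off k r < off k (Suc r)" by (simp_all add: off_def)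
qed

text \<open>With \<open>v = 8 * 2 ^ k * eps\<close> the scale \<open>s = epsr r / (72 * v)\<close> is small enough that the variance term of
  the tail bound costs at most half of the linear term.\<close>

lemma round_exponent: "L * (real r + 1) \<le> real (n k r) * (epsr r / (576 * (2 ^ k * eps)) * (epsr r / 4))"
proof -
  define a where "a = epsr r / (576 * (2 ^ k * eps)) * (epsr r / 4)"
  \<comment> \<open>\<open>589824 = 16 * 16 * 576 * 4\<close>, from the two factors
    \<open>epsr r\<close> and the two denominators; \<open>n\<close> is calibrated to cancel
    it.\<close>
  have a: "a = (9/16) ^ r * (eps / 2 ^ k) / 589824"
  proof -
    have "((3/4 :: real) ^ r) * (3/4) ^ r = (9/16) ^ r" by (simp flip: power_mult_distrib)
    then show ?thesis using eps_pos unfolding a_def epsr_def by (simp add: field_simps)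
  qed
  have "L * (real r + 1) = (589824 * (2 ^ k * (L / eps)) * ((16/9) ^ r * (real r + 1))) * a"
  proof -
    have "(16/9 :: real) ^ r * (9/16) ^ r = 1" by (simp flip: power_mult_distrib)
    moreover have "(589824 * (2 ^ k * (L / eps)) * ((16/9) ^ r * (real r + 1))) * a
        = ((16/9) ^ r * (9/16) ^ r) * (L * (real r + 1))"
      unfolding a using eps_pos by (simp add: field_simps)
    ultimately show ?thesis by simp
  qed
  also have "\<dots> \<le> real (n k r) * a"
    by (intro mult_right_mono n_bounds) (use eps_pos a in simp)
  finally show ?thesis by (simp add: a_def)
qed

text \<open>Holds for arms of any variance. If the variance is moderate, the scale \<open>s\<close>
  is small enough for it; if it is large, the penalty has pushed \<open>q k j\<close> so far below
  \<open>c\<close> that the gap pays for the variance term.\<close>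

lemma round_upper_tail:
  assumes j: "j \<in> S" and c1: "q k j + epsr r / 2 \<le> c" and c2: "top - 3 / 4 * eps \<le> c"
  shows "\<P>(X in T. c \<le> score k (off k r) (off k (Suc r)) X j) \<le> exp (- (L * (real r + 1)))"
proof -
  define v where "v = 2 ^ k * eps"
  define s where "s = epsr r / (576 * v)"
  define V where "V = var_of (D j)"
  have v: "eps \<le> v" "0 < v" using eps_pos by (auto simp: v_def)
  have V: "0 \<le> V" unfolding V_def by (rule arm.var_nonneg)
  have lam: "lam k = eps / (32 * v)" using eps_pos by (simp add: lam_def v_def)
  have s: "0 < s" "s \<le> 1 / 2"
    using v epsr_bounds[of r] eps_pos by (auto simp: s_def divide_simps)
  have half: "3 * s * V \<le> (c - q k j) / 2"
  \<comment> \<open>Beyond 48 \<open>v\<close> the penalty is at least \<open>3 / 2 * eps\<close>,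
    twice the distance that \<open>c2\<close> allows between \<open>c\<close> and
    \<open>top\<close>, so at least half of the penalty remains as gap.\<close>
  proof (cases "V \<le> 48 * v")
    case True
    have "3 * s * V \<le> 3 * s * (48 * v)" using True s by (intro mult_left_mono) auto
    also have "\<dots> = epsr r / 4" using v by (simp add: s_def)
    also have "\<dots> \<le> (c - q k j) / 2" using c1 by simp
    finally show ?thesis .
  next
    case False
    have "3 * s * V = epsr r * (V / (192 * v))" using v by (simp add: s_def)
    also have "\<dots> \<le> eps / 16 * (V / (192 * v))" 
      using epsr_bounds[of r] V v by (intro mult_right_mono) auto
    also have "\<dots> \<le> eps * (V / (128 * v))"
      using eps_pos V v by (simp add: divide_simps)
    also have "\<dots> = lam k * V / 4" by (simp add: lam)
    also have "\<dots> \<le> (c - q k j) / 2"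
    proof -
      define w where "w = lam k * V"
      have "eps * (48 * v) \<le> eps * V" using False eps_pos by (intro mult_left_mono) auto
      then have "3 / 2 * eps \<le> w" using v unfolding lam w_def by (simp add: field_simps)
      moreover have "q k j \<le> top - w" using mean_le_top[OF j] by (simp add: q_def V_def w_def)
      ultimately have "w / 4 \<le> (c - q k j) / 2" using c2 by simp
      then show ?thesis by (simp add: w_def)
    qed
    finally show ?thesis .
  qed
  have "L * (real r + 1) \<le> real (n k r) * (s * (epsr r / 4))"
    using round_exponent[of r k] by (simp add: s_def v_def)
  also have "\<dots> \<le> real (n k r) * (s * c - s * q k j - 3 * s\<^sup>2 * V)"
  proof (rule mult_left_mono)
    have "epsr r / 4 \<le> c - q k j - 3 * s * V" using half c1 by (simp add: field_simps)
    then have "s * (epsr r / 4) \<le> s * (c - q k j - 3 * s * V)" using s by (intro mult_left_mono) auto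
    then show "s * (epsr r / 4) \<le> s * c - s * q k j - 3 * s\<^sup>2 * V" by (simp add: power2_eq_square algebra_simps)
  qed simp
  finally have "\<P>(X in T. s * c \<le> s * score k (off k r) (off k (Suc r)) X j) \<le> exp (- (L * (real r + 1)))"
    by (intro score_tail j) (use s in \<open>auto simp: block_length V_def\<close>)
  then show ?thesis using s by simp
qed

lemma round_lower_tail:
  assumes i: "i \<in> S" and good: "top - eps / 2 \<le> q k i"
  shows "\<P>(X in T. score k (off k r) (off k (Suc r)) X i \<le> q k i - epsr r / 2) \<le> exp (- (L * (real r + 1)))"
proof -
  define v where "v = 2 ^ k * eps"
  define s where "s = epsr r / (576 * v)"
  define V where "V = var_of (D i)"
  define c where "c = q k i - epsr r / 2"
  have v: "eps \<le> v" "0 < v" using eps_pos by (auto simp: v_def)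
  have s: "0 < s" "s \<le> 1 / 2"
    using v epsr_bounds[of r] eps_pos by (auto simp: s_def divide_simps)
  have "3 * s * V \<le> 3 * s * (16 * v)"
    using variance_of_good_arm[OF i good] s by (intro mult_left_mono) (auto simp: V_def v_def)
  also have "\<dots> = epsr r / 12" using v by (simp add: s_def)
  finally have "epsr r / 4 \<le> q k i - c - 3 * s * V" using epsr_bounds[of r] by (simp add: c_def)
  then have le: "s * (epsr r / 4) \<le> s * (q k i - c - 3 * s * V)" using s by (intro mult_left_mono) auto
  have "L * (real r + 1) \<le> real (n k r) * (s * (epsr r / 4))"
    using round_exponent[of r k] by (simp add: s_def v_def)
  also have "\<dots> \<le> real (n k r) * ((- s) * c - (- s) * q k i - 3 * (- s)\<^sup>2 * V)"
    by (intro mult_left_mono) (use le in \<open>simp_all add: power2_eq_square algebra_simps\<close>)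
  \<comment> \<open>A negative scale turns the upper tail of \<open>score_tail\<close> into the
    lower tail.\<close>
  finally have "\<P>(X in T. (- s) * c \<le> (- s) * score k (off k r) (off k (Suc r)) X i) \<le> exp (- (L * (real r + 1)))"
    by (intro score_tail i) (use s in \<open>auto simp: block_length V_def\<close>)
  then show ?thesis using s by (simp add: c_def)
qed

text \<open>If no near-best arm is kept, then either the best arm \<open>i\<close> scores low, with
  probability at most \<open>p\<close>, or all \<open>c\<close> kept arms are poor and score above
  \<open>t\<close>. At most \<open>2 * c\<close> arms are poor, so Markov's inequality bounds the
  latter by \<open>2 * p\<close>.\<close>

lemma prob_bad_round:
  assumes B: "B \<subseteq> S"
  shows "\<P>(X in T. bad_round k r B X) \<le> 3 * exp (- (L * (real r + 1)))"
proof (cases "B \<noteq> {} \<and> top - eps / 2 \<le> Max (q k ` B)")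
  case False
  then have "\<not> bad_round k r B X" for X unfolding bad_round_def by blast
  then show ?thesis by simp
next
  case True
  define p where "p = exp (- (L * (real r + 1)))"
  define sc where "sc X = score k (off k r) (off k (Suc r)) X" for X
  define c where "c = (card B + 1) div 2"
  have fin: "finite B" using B finite_S finite_subset by blast
  have "Max (q k ` B) \<in> q k ` B" using True fin by (intro Max_in) auto
  then obtain i where i: "i \<in> B" "q k i = Max (q k ` B)" by auto
  \<comment> \<open>The midpoint between \<open>q k i\<close> and the level
    \<open>q k i - epsr r\<close> below which arms are poor: both kinds of error need a deviation of
    \<open>epsr r / 2\<close>.\<close>
  define t where "t = q k i - epsr r / 2"
  define W where "W = {j\<in>B. q k j < q k i - epsr r}"
  have cB: "0 < c" "card B \<le> 2 * c" using i(1) fin card_gt_0_iff[of B] by (auto simp: c_def)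
  have m1 [measurable]: "Measurable.pred T (\<lambda>X. t \<le> sc X j)" "Measurable.pred T (\<lambda>X. sc X j \<le> t)" if "j \<in> B" for j
    unfolding sc_def using that B by (auto intro!: pred_le_real score_measurable)
  have finW: "finite W" using fin by (simp add: W_def)
  have m2: "Measurable.pred T (\<lambda>X. c \<le> card {j\<in>W. t \<le> sc X j})"
  proof -
    have "c \<le> card {j\<in>W. t \<le> sc X j} \<longleftrightarrow> (\<exists>U\<in>Pow W. (\<forall>j\<in>W. t \<le> sc X j \<longleftrightarrow> j \<in> U) \<and> c \<le> card U)" for X
    proof
      assume "c \<le> card {j\<in>W. t \<le> sc X j}"
      then show "\<exists>U\<in>Pow W. (\<forall>j\<in>W. t \<le> sc X j \<longleftrightarrow> j \<in> U) \<and> c \<le> card U"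
        by (intro bexI[of _ "{j\<in>W. t \<le> sc X j}"]) auto
    next
      assume "\<exists>U\<in>Pow W. (\<forall>j\<in>W. t \<le> sc X j \<longleftrightarrow> j \<in> U) \<and> c \<le> card U"
      then obtain U where "U \<subseteq> W" "\<forall>j\<in>W. t \<le> sc X j \<longleftrightarrow> j \<in> U" "c \<le> card U" by blast
      moreover from this have "{j\<in>W. t \<le> sc X j} = U" by blast
      ultimately show "c \<le> card {j\<in>W. t \<le> sc X j}" by simp
    qed
    moreover have "Measurable.pred T (\<lambda>X. \<exists>U\<in>Pow W. (\<forall>j\<in>W. t \<le> sc X j \<longleftrightarrow> j \<in> U) \<and> c \<le> card U)"
      by (intro pred_intros_finite(3,4) pred_and_const pred_intros_logic(6) m1) (use finW W_def in auto)
    ultimately show ?thesis by (simp only:)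
  qed
  have sub: "bad_round k r B X \<Longrightarrow> sc X i \<le> t \<or> c \<le> card {j\<in>W. t \<le> sc X j}" for X
  proof (rule ccontr)
    assume bad: "bad_round k r B X" and "\<not> (sc X i \<le> t \<or> c \<le> card {j\<in>W. t \<le> sc X j})"
    then have n: "t < sc X i" "\<not> c \<le> card {j\<in>W. t \<le> sc X j}" by auto
    have top: "\<forall>j\<in>top_half B (sc X). q k j < q k i - epsr r"
      using bad i by (simp add: bad_round_def sc_def)
    have "i \<notin> top_half B (sc X)" using top epsr_bounds[of r] by fastforce
    then have "sc X i \<le> sc X j" if "j \<in> top_half B (sc X)" for j
      using top_half_beats[OF fin, of i "sc X" j] that i by auto
    then have "top_half B (sc X) \<subseteq> {j\<in>W. t \<le> sc X j}"
      using n top top_half_subset[of B "sc X"] by (fastforce simp: W_def)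
    then have "card (top_half B (sc X)) \<le> card {j\<in>W. t \<le> sc X j}"
      by (intro card_mono) (use finW in auto)
    then show False using n by (simp add: card_top_half[OF fin] c_def)
  qed
  have "\<P>(X in T. bad_round k r B X) \<le> \<P>(X in T. sc X i \<le> t \<or> c \<le> card {j\<in>W. t \<le> sc X j})"
    by (rule T.finite_measure_mono) (use sub m1(2)[OF i(1)] m2 in \<open>auto intro!: pred_intros_logic(5)[unfolded pred_def]  simp: pred_def\<close>)
  also have "\<dots> \<le> \<P>(X in T. sc X i \<le> t) + \<P>(X in T. c \<le> card {j\<in>W. t \<le> sc X j})"
    using m1(2)[OF i(1)] m2
    unfolding conj_disj_distribL Collect_disj_eq by (intro measure_Un_le) (simp_all add: pred_def)
  also have "\<P>(X in T. sc X i \<le> t) \<le> p"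
    unfolding sc_def t_def p_def by (rule round_lower_tail) (use i B True in auto)
  also have "\<P>(X in T. c \<le> card {j\<in>W. t \<le> sc X j}) \<le> real (card W) * p / real c"
  proof (rule T.prob_card_ge[OF finW _ _ cB(1)])
    fix j assume j: "j \<in> W"
    show "Measurable.pred T (\<lambda>X. t \<le> sc X j)" using j by (intro m1) (simp add: W_def)
    show "\<P>(X in T. t \<le> sc X j) \<le> p"
      unfolding sc_def p_def
      by (rule round_upper_tail)
         (use j B True i(2) epsr_bounds[of r] eps_pos in \<open>auto simp: W_def t_def\<close>)
  qed
  also have "real (card W) * p / real c \<le> 2 * p"
  proof -
    have "card W \<le> 2 * c" using cB(2) card_mono[OF fin, of W] by (auto simp: W_def)
    then have "real (card W) * p \<le> (2 * real c) * p" by (intro mult_right_mono) (auto simp: p_def)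
    then show ?thesis using cB(1) by (simp add: divide_le_eq algebra_simps)
  qed
  finally show ?thesis by (simp add: p_def)
qed

lemma prob_bad_final:
  assumes B: "B \<subseteq> S"
  shows "\<P>(X in T. bad_final k B X) \<le> 2 * exp (- L)"
proof (cases "card B \<le> 1 \<and> B \<noteq> {}")
  case False
  then have "\<not> bad_final k B X" for X unfolding bad_final_def by blast
  then show ?thesis by simp
next
  case True
  have "finite B" using B finite_S finite_subset by blast
  with True have "card B = 1" by (metis card_0_eq le_antisym less_one linorder_not_le)
  then obtain j where Bj: "B = {j}" by (rule card_1_singletonE)
  with B have j: "j \<in> S" by simp
  define v where "v = 2 ^ k * eps"
  have v: "eps \<le> v" "0 < v" using eps_pos by (auto simp: v_def)
  define V where "V = var_of (D j)"
  define sc where "sc X = score k m (m + f k) X j" for X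
  have [measurable]: "sc \<in> borel_measurable T" unfolding sc_def[abs_def] by (rule score_measurable[OF j])
  have V: "0 \<le> V" unfolding V_def by (rule arm.var_nonneg)
  have fpos: "m < m + f k" 
  proof -
    have "0 < 3072 * (2 ^ k * (L / eps))" using L_ge_1 eps_pos by simp
    then have "0 < real (f k)" using f_bounds(1)[of k] by linarith
    then show ?thesis by simp
  qed
  have fl: "L \<le> real (f k) * (eps / (3072 * 2 ^ k))"
  proof -
    have "L = 3072 * (2 ^ k * (L / eps)) * (eps / (3072 * 2 ^ k))" using eps_pos by simp
    also have "\<dots> \<le> real (f k) * (eps / (3072 * 2 ^ k))"
      by (intro mult_right_mono f_bounds) (use eps_pos in simp)
    finally show ?thesis .
  qed
  have upper: "\<P>(X in T. mean_of (D j) + eps / 4 \<le> sc X) \<le> exp (- L)"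
  proof -
    \<comment> \<open>With this scale \<open>3 * s\<^sup>2 * V\<close> equals
      \<open>s * lam k * V\<close>, so the variance term cancels the penalty exactly and no bound on
      \<open>V\<close> is required.\<close>
    define s where "s = lam k / 3"
    have s: "0 < s" "s \<le> 1 / 2" using lam_bounds[of k] by (auto simp: s_def)
    have "L \<le> real (f k) * (eps / (3072 * 2 ^ k))" by (rule fl)
    also have "\<dots> \<le> real (f k) * (s * (mean_of (D j) + eps / 4) - s * q k j - 3 * s\<^sup>2 * V)"
    proof (rule mult_left_mono)
      have "s * (mean_of (D j) + eps / 4) - s * q k j - 3 * s\<^sup>2 * V = s * eps / 4"
        by (simp add: q_def s_def V_def power2_eq_square field_simps)
      moreover have "eps / (3072 * 2 ^ k) \<le> s * eps / 4"
        using eps_pos by (simp add: s_def lam_def field_simps)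
      ultimately show "eps / (3072 * 2 ^ k) \<le> s * (mean_of (D j) + eps / 4) - s * q k j - 3 * s\<^sup>2 * V" by simp
    qed simp
    finally have "\<P>(X in T. s * (mean_of (D j) + eps / 4) \<le> s * score k m (m + f k) X j) \<le> exp (- L)"
      by (intro score_tail j fpos) (use s in \<open>auto simp: V_def\<close>)
    then show ?thesis using s by (simp add: sc_def)
  qed
  have lower: "\<P>(X in T. sc X \<le> q k j - eps / 4) \<le> exp (- L)" if good: "top - eps / 2 \<le> q k j"
  proof -
    \<comment> \<open>Makes the variance term at most \<open>eps / 8\<close>, half of the deviation
      \<open>eps / 4\<close>; then \<open>3072 = 384 * 8\<close>.\<close>
    define s where "s = 1 / (384 * 2 ^ k :: real)"
    define c where "c = q k j - eps / 4"
    have "1 \<le> (2 :: real) ^ k" by simp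
    then have "1 \<le> 192 * (2 :: real) ^ k" by linarith
    then have s: "0 < s" "s \<le> 1 / 2" by (simp_all add: s_def divide_simps)
    have "3 * s * V \<le> 3 * s * (16 * v)"
      using variance_of_good_arm[OF j good] s by (intro mult_left_mono) (auto simp: V_def v_def)
    also have "\<dots> = eps / 8" by (simp add: s_def v_def)
    finally have "eps / 8 \<le> q k j - c - 3 * s * V" by (simp add: c_def)
    then have le: "s * (eps / 8) \<le> s * (q k j - c - 3 * s * V)" using s by (intro mult_left_mono) auto
    have "L \<le> real (f k) * (eps / (3072 * 2 ^ k))" by (rule fl)
    also have "eps / (3072 * 2 ^ k) = s * (eps / 8)" by (simp add: s_def)
    also have "real (f k) * \<dots> \<le> real (f k) * ((- s) * c - (- s) * q k j - 3 * (- s)\<^sup>2 * V)"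
      by (intro mult_left_mono) (use le in \<open>simp_all add: power2_eq_square algebra_simps\<close>)
    finally have "\<P>(X in T. (- s) * c \<le> (- s) * score k m (m + f k) X j) \<le> exp (- L)"
      by (intro score_tail j fpos) (use s in \<open>auto simp: V_def\<close>)
    then show ?thesis using s by (simp add: c_def sc_def)
  qed
  have "\<P>(X in T. bad_final k B X)
      = T.prob ({X\<in>space T. mean_of (D j) + eps / 4 \<le> sc X} \<union> {X\<in>space T. top - eps / 2 \<le> q k j \<and> sc X \<le> q k j - eps / 4})"
    by (rule arg_cong[of _ _ T.prob]) (auto simp: bad_final_def Bj sc_def)
  also have "\<dots> \<le> \<P>(X in T. mean_of (D j) + eps / 4 \<le> sc X) + \<P>(X in T. top - eps / 2 \<le> q k j \<and> sc X \<le> q k j - eps / 4)"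
    by (rule measure_Un_le) measurable
  also have "\<dots> \<le> exp (- L) + exp (- L)"
    using upper lower by (intro add_mono) (cases "top - eps / 2 \<le> q k j"; simp)+
  finally show ?thesis by simp
qed

section \<open>Tail bounds for the variance estimates\<close>

lemma half_sq_tail:
  assumes Q: "Q \<subseteq> S" and s: "s = 1 \<or> s = -1"
    and b: "\<And>i. (\<integral>z. exp (s * half_sq z) \<partial>(D i \<Otimes>\<^sub>M D i)) \<le> exp (b i)"
  shows "\<P>(X in T. s * c \<le> s * (\<Sum>i\<in>Q. vhat X i)) \<le> exp (real m * ((\<Sum>i\<in>Q. b i) - s * c))"
proof -
  have fin: "finite Q" using Q finite_S finite_subset by blast
  have int: "integrable (D i \<Otimes>\<^sub>M D i) (\<lambda>z. exp (s * half_sq z))" for i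
  proof (rule arm.integrable_exp_DD[where B=1])
    fix x y :: real assume "0 \<le> x" "x \<le> 1" "0 \<le> y" "y \<le> 1"
    from half_sq_bounds[OF this] s show "s * half_sq (x, y) \<le> 1" by auto
  qed simp
  have "s * c \<le> s * (\<Sum>i\<in>Q. vhat X i) \<longleftrightarrow>
      real m * (s * c) \<le> (\<Sum>p\<in>Q \<times> {..<m}. s * half_sq (pair X p))" for X
  proof -
    have "(\<Sum>p\<in>Q \<times> {..<m}. s * half_sq (pair X p)) = (\<Sum>i\<in>Q. \<Sum>p<m. s * half_sq (pair X (i, p)))"
      using sum.cartesian_product[of "\<lambda>i p. s * half_sq (pair X (i, p))" "{..<m}" Q] by simp
    also have "\<dots> = (\<Sum>i\<in>Q. real m * (s * vhat X i))"
      using m_pos by (intro sum.cong) (simp_all add: vhat_def flip: sum_distrib_left)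
    also have "\<dots> = real m * (s * (\<Sum>i\<in>Q. vhat X i))" by (simp only: sum_distrib_left)
    finally show ?thesis using m_pos by simp
  qed
  then have "\<P>(X in T. s * c \<le> s * (\<Sum>i\<in>Q. vhat X i))
      = \<P>(X in T. real m * (s * c) \<le> (\<Sum>p\<in>Q \<times> {..<m}. s * half_sq (pair X p)))" by simp
  also have "\<dots> \<le> exp ((\<Sum>p\<in>Q \<times> {..<m}. b (fst p)) - real m * (s * c))"
    by (rule chernoff[where g="\<lambda>_ z. s * half_sq z"]) (use Q fin int b in auto)
  also have "(\<Sum>p\<in>Q \<times> {..<m}. b (fst p)) = (\<Sum>i\<in>Q. \<Sum>p<m. b i)"
    using sum.cartesian_product[of "\<lambda>i p. b i" "{..<m}" Q] by (simp add: split_beta)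
  also have "\<dots> = real m * (\<Sum>i\<in>Q. b i)" by (simp add: sum_distrib_left)
  finally show ?thesis by (simp add: right_diff_distrib)
qed

text \<open>The exponent is \<open>- m * (V / 4 + eps)\<close>; the additive slack alone already
  supplies \<open>L\<close>. The bound is later applied to one optimal arm only.\<close>

lemma prob_vhat_small:
  assumes "i \<in> S"
  shows "\<P>(X in T. vhat X i \<le> var_of (D i) / 4 - eps) \<le> exp (- L)"
proof -
  have "\<P>(X in T. vhat X i \<le> var_of (D i) / 4 - eps)
      = \<P>(X in T. (-1) * (var_of (D i) / 4 - eps) \<le> (-1) * (\<Sum>j\<in>{i}. vhat X j))"
    by (intro arg_cong[of _ _ T.prob] Collect_cong) auto
  also have "\<dots> \<le> exp (real m * ((\<Sum>j\<in>{i}. - var_of (D j) / 2) - (-1) * (var_of (D i) / 4 - eps)))"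
    by (rule half_sq_tail) (use assms arm.exp_neg_half_sq_le in auto)
  also have "\<dots> \<le> exp (- (real m * eps))"
    using mult_nonneg_nonneg[of "real m" "var_of (D i)"] arm.var_nonneg[of i] by (simp add: algebra_simps)
  also have "\<dots> \<le> exp (- L)" using m_ge by simp
  finally show ?thesis .
qed

text \<open>A single Chernoff bound over the pairs of all arms. The additive slack is
  \<open>eps\<close> for the whole sum, and the failure probability does not grow with
  \<open>card S\<close>.\<close>

lemma prob_sum_vhat_large:
  "\<P>(X in T. 2 * (\<Sum>i\<in>S. var_of (D i)) + eps \<le> (\<Sum>i\<in>S. vhat X i)) \<le> exp (- L)"
proof -
  have "\<P>(X in T. 2 * (\<Sum>i\<in>S. var_of (D i)) + eps \<le> (\<Sum>i\<in>S. vhat X i))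
      = \<P>(X in T. 1 * (2 * (\<Sum>i\<in>S. var_of (D i)) + eps) \<le> 1 * (\<Sum>i\<in>S. vhat X i))" by simp
  also have "\<dots> \<le> exp (real m * ((\<Sum>i\<in>S. 2 * var_of (D i)) - 1 * (2 * (\<Sum>i\<in>S. var_of (D i)) + eps)))"
    by (rule half_sq_tail) (use arm.exp_half_sq_le in auto)
  also have "\<dots> = exp (- (real m * eps))" by (simp add: sum_distrib_left)
  also have "\<dots> \<le> exp (- L)" using m_ge by simp
  finally show ?thesis .
qed

lemma prob_bad_round_surv: "\<P>(X in T. bad_round k r (surv X k r) X) \<le> 3 * exp (- (L * (real r + 1)))"
proof (rule prob_selected_le[where I="Pow S"
      and J="{..<2 * m} \<union> {2 * off k 0..<2 * off k r}" and K="{2 * off k r..<2 * off k (Suc r)}"])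
  show "determined_by {2 * off k r..<2 * off k (Suc r)} (bad_round k r B)" if "B \<in> Pow S" for B
    unfolding determined_by_def
  proof (intro allI impI)
    fix X Y assume a: "agree S (\<lambda>_. {2 * off k r..<2 * off k (Suc r)}) X Y"
    have "top_half B (score k (off k r) (off k (Suc r)) X) = top_half B (score k (off k r) (off k (Suc r)) Y)"
      by (rule top_half_cong, rule score_determined[OF _ a]) (use that in auto)
    then show "bad_round k r B X = bad_round k r B Y" by (simp add: bad_round_def)
  qed
  have "m \<le> off k r" by (simp add: off_def)
  then show "({..<2 * m} \<union> {2 * off k 0..<2 * off k r}) \<inter> {2 * off k r..<2 * off k (Suc r)} = {}" by auto
qed (use finite_S surv_subset surv_determined prob_bad_round in auto)

lemma prob_bad_final_surv: "\<P>(X in T. bad_final k (surv X k R) X) \<le> 2 * exp (- L)"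
proof (rule prob_selected_le[where I="Pow S"
      and J="{..<2 * m} \<union> {2 * off k 0..<2 * off k R}" and K="{2 * m..<2 * (m + f k)}"])
  show "determined_by {2 * m..<2 * (m + f k)} (bad_final k B)" if "B \<in> Pow S" for B
    unfolding determined_by_def
  proof (intro allI impI)
    fix X Y assume a: "agree S (\<lambda>_. {2 * m..<2 * (m + f k)}) X Y"
    have "score k m (m + f k) X j = score k m (m + f k) Y j" if "j \<in> B" for j
      by (rule score_determined[OF _ a]) (use that \<open>B \<in> Pow S\<close> in auto)
    then show "bad_final k B X = bad_final k B Y" by (simp add: bad_final_def)
  qed
  have "off k 0 = m + f k" by (simp add: off_def)
  then show "({..<2 * m} \<union> {2 * off k 0..<2 * off k R}) \<inter> {2 * m..<2 * (m + f k)} = {}" by auto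
qed (use finite_S surv_subset surv_determined prob_bad_final in auto)

text \<open>Four losses of at most \<open>eps / 4\<close> each: the penalty of the optimal arm, the
  elimination rounds, the undershoot of the near-optimal survivor of its group, and the overshoot of
  the final winner.\<close>

lemma out_correct:
  assumes i: "i \<in> S" "mean_of (D i) = top"
    and vhat: "\<not> vhat X i \<le> var_of (D i) / 4 - eps"
    and round: "\<And>k r. k \<le> K \<Longrightarrow> r < R \<Longrightarrow> \<not> bad_round k r (surv X k r) X"
    and fin: "\<And>k. k \<le> K \<Longrightarrow> \<not> bad_final k (surv X k R) X"
  shows "out X \<in> S \<and> \<bar>mean_of (D (out X)) - top\<bar> \<le> eps"
proof -
  define k where "k = lev X i"
  have kK: "k \<le> K" by (simp add: k_def lev_le_K)
  \<comment> \<open>Below the cap, \<open>V / 4 - eps\<close> is less than the estimate and hence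
    than \<open>2 ^ k * eps\<close>; multiplying by 4 and using \<open>eps \<le> 2 ^ k * eps\<close>
    gives the 8.\<close>
  have "var_of (D i) \<le> 8 * (2 ^ k * eps)"
  proof (cases "k = K")
    case True
    then show ?thesis using two_pow_K arm.var_le_1[of i] by simp
  next
    case False
    then have "vhat X i \<le> 2 ^ k * eps" using lev_bounds[of X i] by (simp add: k_def)
    moreover have "1 * eps \<le> 2 ^ k * eps" using eps_pos by (intro mult_right_mono) auto
    ultimately show ?thesis using vhat by simp
  qed
  then have "lam k * var_of (D i) \<le> lam k * (8 * (2 ^ k * eps))"
    using lam_bounds[of k] by (intro mult_left_mono) auto
  then have q_i: "top - eps / 4 \<le> q k i" by (simp add: q_def i(2) lam_def)
  have "\<exists>j\<in>surv X k r. top - eps / 4 - (\<Sum>r'<r. epsr r') \<le> q k j" if "r \<le> R" for r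
    using that
  proof (induction r)
    case 0
    then show ?case using q_i i(1) by (auto simp: k_def)
  next
    case (Suc r)
    then obtain j where j: "j \<in> surv X k r" "top - eps / 4 - (\<Sum>r'<r. epsr r') \<le> q k j" by auto
    have jM: "q k j \<le> Max (q k ` surv X k r)" using j(1) by (intro Max_ge) auto
    have "top - eps / 2 \<le> Max (q k ` surv X k r)" using j(2) jM sum_epsr[of r] by linarith
    moreover have "\<not> bad_round k r (surv X k r) X" using round[OF kK] Suc.prems by simp
    ultimately obtain j' where j': "j' \<in> surv X k (Suc r)" "Max (q k ` surv X k r) - epsr r \<le> q k j'"
      using j(1) unfolding bad_round_def surv.simps by fastforce
    then show ?case using j(2) jM by (intro bexI[OF _ j'(1)]) simp
  qed
  from this[of R] obtain j where j: "j \<in> surv X k R" "top - eps / 2 \<le> q k j"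
    using sum_epsr[of R] by fastforce
  have jl: "lev X j = k" "j \<in> S" using surv_D[OF j(1)] by auto
  with j have jw: "j \<in> winners X" by (simp add: winners_def)
  have "q k j - eps / 4 < score k m (m + f k) X j"
    using fin[OF kK] j card_surv_R[of X k] unfolding bad_final_def by force
  then have "top - 3 / 4 * eps < final X j" using j(2) by (simp add: final_def jl)
  moreover have "final X j \<le> final X (out X)" "out X \<in> winners X" using out_winner jw by auto
  moreover have "final X (out X) < mean_of (D (out X)) + eps / 4"
  proof -
    have "out X \<in> surv X (lev X (out X)) R" using out_winner by (auto simp: winners_def)
    then show ?thesis
      using fin[OF lev_le_K, of X "out X"] card_surv_R[of X "lev X (out X)"]
      unfolding bad_final_def final_def by force
  qed
  ultimately have "out X \<in> S" "top - eps < mean_of (D (out X))" by (auto simp: winners_def)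
  then show ?thesis using mean_le_top[of "out X"] by auto
qed

text \<open>Charging levels to estimates and estimates to variances leaves \<open>4 * V\<close> plus
  multiples of \<open>eps\<close>; the single slack \<open>eps\<close> is absorbed by
  \<open>card S * eps\<close> because there is at least one arm.\<close>

lemma demand_le_complexity:
  assumes "\<not> 2 * (\<Sum>i\<in>S. var_of (D i)) + eps \<le> (\<Sum>i\<in>S. vhat X i)"
  shows "real (\<Sum>i\<in>S. demand (Suc R) X i) \<le> 8 * 10 ^ 8 * L * (\<Sum>i\<in>S. var_of (D i) / eps\<^sup>2 + 1 / eps)"
proof -
  define V where "V = (\<Sum>i\<in>S. var_of (D i))"
  define P where "P = (\<Sum>i\<in>S. 2 ^ lev X i :: real)"
  have "P * eps = (\<Sum>i\<in>S. 2 ^ lev X i * eps)" by (simp add: P_def sum_distrib_right)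
  also have "\<dots> \<le> (\<Sum>i\<in>S. 2 * vhat X i + eps)" by (intro sum_mono two_pow_lev_le)
  also have "\<dots> = 2 * (\<Sum>i\<in>S. vhat X i) + real (card S) * eps" by (simp add: sum.distrib sum_distrib_left)
  also have "\<dots> \<le> 4 * V + 2 * eps + real (card S) * eps" using assms by (simp add: V_def)
  also have "\<dots> \<le> 4 * (V + real (card S) * eps)"
  proof -
    have "1 \<le> card S" using finite_S S_nonempty card_gt_0_iff[of S] by linarith
    then have "1 * eps \<le> real (card S) * eps" using eps_pos by (intro mult_right_mono) auto
    then have "2 * eps \<le> 3 * (real (card S) * eps)" using eps_pos by linarith
    then show ?thesis by (simp add: algebra_simps)
  qed
  finally have P: "P \<le> 4 * (V + real (card S) * eps) / eps" using eps_pos by (simp add: le_divide_eq)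
  have "real (\<Sum>i\<in>S. demand (Suc R) X i) \<le> 2 * 10 ^ 8 * (L / eps) * P"
    unfolding P_def by (rule demand_le)
  also have "\<dots> \<le> 2 * 10 ^ 8 * (L / eps) * (4 * (V + real (card S) * eps) / eps)"
    using P L_ge_1 eps_pos by (intro mult_left_mono) auto
  also have "\<dots> = 8 * 10 ^ 8 * L * (V / eps\<^sup>2 + real (card S) / eps)"
    using eps_pos by (simp add: field_simps power2_eq_square)
  also have "V / eps\<^sup>2 + real (card S) / eps = (\<Sum>i\<in>S. var_of (D i) / eps\<^sup>2 + 1 / eps)"
    by (simp add: V_def sum.distrib sum_divide_distrib)
  finally show ?thesis .
qed

text \<open>As \<open>L\<close> is at least 1, \<open>exp (- L)\<close> is at most 1/2, and the
  factor \<open>r + 1\<close> in the exponent yields a geometric series.\<close>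

lemma sum_round_failures: "(\<Sum>r<R. 3 * exp (- (L * (real r + 1)))) \<le> 6 * exp (- L)"
proof -
  have e: "exp (- L) \<le> 1 / 2"
  proof -
    have "2 \<le> exp L" using exp_ge_add_one_self[of L] L_ge_1 by linarith
    then show ?thesis by (simp add: exp_minus inverse_eq_divide divide_simps)
  qed
  have "(\<Sum>r<R. 3 * exp (- (L * (real r + 1)))) \<le> (\<Sum>r<R. 3 * exp (- L) * (1 / 2) ^ r)"
  proof (rule sum_mono)
    fix r
    have "exp (- (L * (real r + 1))) = exp (- L) * exp (- L) ^ r"
      by (simp add: exp_of_nat_mult[symmetric] exp_add[symmetric] algebra_simps)
    also have "\<dots> \<le> exp (- L) * (1 / 2) ^ r"
      using e by (intro mult_left_mono power_mono) auto
    finally show "3 * exp (- (L * (real r + 1))) \<le> 3 * exp (- L) * (1 / 2) ^ r" by simp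
  qed
  also have "\<dots> = 3 * exp (- L) * (\<Sum>r<R. (1 / 2) ^ r)" by (simp only: sum_distrib_left)
  also have "\<dots> \<le> 3 * exp (- L) * 2"
  proof (rule mult_left_mono)
    have "(\<Sum>r<n. (1 / 2 :: real) ^ r) = 2 - 2 * (1 / 2) ^ n" for n by (induction n) simp_all
    then show "(\<Sum>r<R. (1 / 2 :: real) ^ r) \<le> 2" by simp
  qed simp
  finally show ?thesis by simp
qed

lemma success_measurable:
  "Measurable.pred T (\<lambda>X. out X \<in> S \<and> \<bar>mean_of (D (out X)) - top\<bar> \<le> eps \<and> real (\<Sum>i\<in>S. demand (Suc R) X i) \<le> B)"
proof -
  have 1: "Measurable.pred T (\<lambda>X. out X \<in> S \<and> \<bar>mean_of (D (out X)) - top\<bar> \<le> eps)"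
    by (rule measurable_compose[OF out_measurable]) simp
  have "(\<lambda>X. \<Sum>i\<in>S. real (demand (Suc R) X i)) \<in> borel_measurable T"
    by (intro borel_measurable_sum measurable_compose[OF demand_measurable]) auto
  then have 2: "Measurable.pred T (\<lambda>X. real (\<Sum>i\<in>S. demand (Suc R) X i) \<le> B)"
    unfolding of_nat_sum by (rule pred_le_real) simp
  show ?thesis using pred_intros_logic(3)[OF 1 2] by (simp add: conj_assoc)
qed

text \<open>Each of the \<open>K + 1\<close> levels contributes at most 6 for its rounds and 2 for
  the last comparison, in units of \<open>exp (- L)\<close>; the two estimate failures account for
  the rest of the 10.\<close>

lemma prob_success:
  assumes B: "8 * 10 ^ 8 * L * (\<Sum>i\<in>S. var_of (D i) / eps\<^sup>2 + 1 / eps) \<le> B"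
  shows "1 - 10 * (real K + 1) * exp (- L)
    \<le> \<P>(X in T. out X \<in> S \<and> \<bar>mean_of (D (out X)) - top\<bar> \<le> eps \<and> real (\<Sum>i\<in>S. demand (Suc R) X i) \<le> B)"
    (is "_ \<le> \<P>(X in T. ?ok X)")
proof -
  have "top \<in> (\<lambda>i. mean_of (D i)) ` S"
    unfolding top_def using finite_S S_nonempty by (intro Max_in) auto
  then obtain i where i: "i \<in> S" "mean_of (D i) = top" by auto
  define E1 where "E1 = {X\<in>space T. vhat X i \<le> var_of (D i) / 4 - eps}"
  define E2 where "E2 = {X\<in>space T. 2 * (\<Sum>i\<in>S. var_of (D i)) + eps \<le> (\<Sum>i\<in>S. vhat X i)}"
  define E3 where "E3 k r = {X\<in>space T. bad_round k r (surv X k r) X}" for k r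
  define E4 where "E4 k = {X\<in>space T. bad_final k (surv X k R) X}" for k
  have sets: "E1 \<in> sets T" "E2 \<in> sets T" "E3 k r \<in> sets T" "E4 k \<in> sets T" for k r
  proof -
    show "E1 \<in> sets T" unfolding E1_def using i(1) by measurable
    have "(\<lambda>X. \<Sum>i\<in>S. vhat X i) \<in> borel_measurable T" by (intro borel_measurable_sum vhat_measurable)
    then show "E2 \<in> sets T" unfolding E2_def by measurable
    have "Measurable.pred T (\<lambda>X. bad_round k r (surv X k r) X)"
      by (rule surv_measurable[where P="bad_round k r"]) (rule bad_round_measurable)
    then show "E3 k r \<in> sets T" unfolding E3_def by (simp add: pred_def)
    have "Measurable.pred T (\<lambda>X. bad_final k (surv X k R) X)"
      by (rule surv_measurable[where P="bad_final k"]) (rule bad_final_measurable)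
    then show "E4 k \<in> sets T" unfolding E4_def by (simp add: pred_def)
  qed
  have ok: "?ok X" if X: "X \<in> space T" and n: "X \<notin> E1 \<union> E2 \<union> (\<Union>k\<le>K. (\<Union>r<R. E3 k r) \<union> E4 k)" for X
  proof -
    have "out X \<in> S \<and> \<bar>mean_of (D (out X)) - top\<bar> \<le> eps"
      by (rule out_correct[OF i]) (use n X in \<open>auto simp: E1_def E3_def E4_def\<close>)
    moreover have "real (\<Sum>i\<in>S. demand (Suc R) X i) \<le> B"
      by (rule order_trans[OF demand_le_complexity B]) (use n X in \<open>auto simp: E2_def\<close>)
    ultimately show ?thesis by simp
  qed
  let ?F = "E1 \<union> E2 \<union> (\<Union>k\<le>K. (\<Union>r<R. E3 k r) \<union> E4 k)"
  have sets_E34: "(\<Union>r<R. E3 k r) \<in> sets T" "(\<Union>r<R. E3 k r) \<union> E4 k \<in> sets T" for k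
    using sets by auto
  then have sets_UN: "(\<Union>k\<le>K. (\<Union>r<R. E3 k r) \<union> E4 k) \<in> sets T" by blast
  have le: "T.prob ((\<Union>r<R. E3 k r) \<union> E4 k) \<le> 8 * exp (- L)" for k
  proof -
    have "T.prob ((\<Union>r<R. E3 k r) \<union> E4 k) \<le> T.prob (\<Union>r<R. E3 k r) + T.prob (E4 k)"
      by (rule measure_Un_le[OF sets_E34(1) sets(4)])
    also have "T.prob (\<Union>r<R. E3 k r) \<le> (\<Sum>r<R. T.prob (E3 k r))"
      by (rule measure_UNION_le) (auto simp: sets)
    also have "\<dots> \<le> (\<Sum>r<R. 3 * exp (- (L * (real r + 1))))"
      unfolding E3_def by (intro sum_mono prob_bad_round_surv)
    also have "\<dots> \<le> 6 * exp (- L)" by (rule sum_round_failures)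
    also have "T.prob (E4 k) \<le> 2 * exp (- L)" unfolding E4_def by (rule prob_bad_final_surv)
    finally show ?thesis by simp
  qed
  have "T.prob ?F \<le> T.prob (E1 \<union> E2) + T.prob (\<Union>k\<le>K. (\<Union>r<R. E3 k r) \<union> E4 k)"
    by (rule measure_Un_le[OF sets.Un[OF sets(1,2)] sets_UN])
  also have "T.prob (E1 \<union> E2) \<le> T.prob E1 + T.prob E2" by (rule measure_Un_le[OF sets(1,2)])
  also have "T.prob E1 \<le> exp (- L)" unfolding E1_def by (rule prob_vhat_small[OF i(1)])
  also have "T.prob E2 \<le> exp (- L)" unfolding E2_def by (rule prob_sum_vhat_large)
  also have "T.prob (\<Union>k\<le>K. (\<Union>r<R. E3 k r) \<union> E4 k) \<le> (\<Sum>k\<le>K. T.prob ((\<Union>r<R. E3 k r) \<union> E4 k))"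
    by (rule measure_UNION_le) (auto simp: sets_E34)
  also have "\<dots> \<le> (\<Sum>k\<le>K. 8 * exp (- L))" by (rule sum_mono) (rule le)
  also have "exp (- L) + exp (- L) + \<dots> \<le> 10 * (real K + 1) * exp (- L)"
    by (simp add: algebra_simps)
  finally have "T.prob ?F \<le> 10 * (real K + 1) * exp (- L)" by simp
  moreover have "1 - T.prob ?F = T.prob (space T - ?F)"
    by (rule T.prob_compl[symmetric], rule sets.Un[OF sets.Un[OF sets(1,2)] sets_UN])
  moreover have "T.prob (space T - ?F) \<le> \<P>(X in T. ?ok X)"
    by (rule T.finite_measure_mono) (use ok success_measurable[of B] in \<open>auto simp: pred_def\<close>)
  ultimately show ?thesis by linarith
qed

end

text \<open>The \<open>LL\<close> term divides by \<open>exp 1 + ln (1 / eps)\<close>, which up to a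
  factor 2 bounds the number of levels; the summand 5 absorbs the remaining factor 20, and since
  \<open>LL\<close> is at least 1 it costs only the factor 6.\<close>

lemma failure_budget:
  assumes eps: "0 < eps" "eps < 1" and delta: "0 < delta" "delta \<le> 1 / 2"
  defines "L \<equiv> ln (1 / delta) + LL (1 / eps) + 5"
  shows "1 \<le> L" "L \<le> 6 * (ln (1 / delta) + LL (1 / eps))"
    "10 * (real (nat \<lceil>log 2 (1 / eps)\<rceil>) + 1) * exp (- L) \<le> delta"
proof -
  have l: "0 \<le> ln (1 / eps)" "0 \<le> ln (1 / delta)" using eps delta by simp_all
  have "ln (exp 1) \<le> LL (1 / eps)"
    unfolding LL_def by (rule ln_mono) (use l(1) in \<open>auto intro: add_pos_nonneg\<close>)
  then have LL: "1 \<le> LL (1 / eps)" by simp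
  with l show "1 \<le> L" "L \<le> 6 * (ln (1 / delta) + LL (1 / eps))" by (simp_all add: L_def)
  have "real (nat \<lceil>log 2 (1 / eps)\<rceil>) \<le> log 2 (1 / eps) + 1" using eps by (simp add: ceiling_correct)
  also have "log 2 (1 / eps) \<le> 2 * ln (1 / eps)"
  proof -
    have "ln (1 / eps) * 1 \<le> ln (1 / eps) * (2 * ln 2)" using l(1) ln2_ge_two_thirds by (intro mult_left_mono) auto
    then show ?thesis by (simp add: log_def divide_le_eq)
  qed
  finally have K: "real (nat \<lceil>log 2 (1 / eps)\<rceil>) + 1 \<le> 2 * (exp 1 + ln (1 / eps))"
    using exp_ge_add_one_self[of "1 :: real"] by simp
  define d where "d = exp 1 + ln (1 / eps)"
  have pos: "0 < d" unfolding d_def using l(1) by (intro add_pos_nonneg) auto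
  have "ln (1 / delta) = - ln delta" using delta by (simp add: ln_div)
  then have "- L = ln delta - ln d - 5" by (simp add: L_def LL_def d_def)
  then have "exp (- L) = delta / d / exp 5" using delta pos by (simp add: exp_diff)
  moreover have "20 \<le> exp (5 :: real)"
  proof -
    have "(2 :: real) ^ 5 \<le> exp 1 ^ 5" using exp_ge_add_one_self[of "1 :: real"] by (intro power_mono) auto
    also have "exp (1 :: real) ^ 5 = exp 5" by (simp flip: exp_of_nat_mult)
    finally show ?thesis by simp
  qed
  ultimately have "exp (- L) \<le> delta / d / 20"
    using delta pos by (simp only:) (intro divide_left_mono, auto)
  then have "10 * (real (nat \<lceil>log 2 (1 / eps)\<rceil>) + 1) * exp (- L)
      \<le> 10 * (2 * d) * (delta / d / 20)"
    using K delta pos by (intro mult_mono) (auto simp: d_def)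
  also have "\<dots> = delta" using pos by simp
  finally show "10 * (real (nat \<lceil>log 2 (1 / eps)\<rceil>) + 1) * exp (- L) \<le> delta" .
qed

text \<open>The event is a rectangle whose seed side is the whole space, of mass 1.\<close>

lemma measure_bandit_space:
  assumes "prob_space (table_space S D)" and A: "{X\<in>space (table_space S D). Q X} \<in> sets (table_space S D)"
  shows "measure (bandit_space S D) {(u, X) \<in> space (bandit_space S D). Q X} = \<P>(X in table_space S D. Q X)"
proof -
  let ?U = "uniform_measure lborel {0..1 :: real}"
  interpret U: prob_space ?U by (rule prob_space_uniform_measure) auto
  interpret T: prob_space "table_space S D" by fact
  have "{(u, X) \<in> space (bandit_space S D). Q X} = space ?U \<times> {X\<in>space (table_space S D). Q X}"
    by (auto simp: bandit_space_def table_space_def space_pair_measure)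
  moreover have "bandit_space S D = ?U \<Otimes>\<^sub>M table_space S D" by (simp add: bandit_space_def table_space_def)
  ultimately show ?thesis
    using T.emeasure_pair_measure_Times[OF sets.top[of ?U] A]
    by (simp add: measure_def U.emeasure_space_1)
qed

lemma unit_distribution_from_support:
  assumes "prob_space M" "sets M = sets borel" "emeasure M {0..1} = 1"
  shows "unit_distribution M"
proof -
  interpret prob_space M by fact
  have "prob {0..1} = 1" using assms(3) by (simp add: measure_def)
  from AE_prob_1[OF this] have "AE x in M. 0 \<le> x \<and> x \<le> 1" by simp
  with assms(2) show ?thesis by unfold_locales
qed

theorem theorem4p1:
  shows "\<exists>C>0. \<forall>(S::nat set) (eps::real) (delta::real).
     finite S \<and> S \<noteq> {} \<and> 0 < eps \<and> eps < 1 \<and> 0 < delta \<and> delta \<le> 1/2 \<longrightarrow>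
     (\<exists>P::policy. \<forall>D::nat \<Rightarrow> real measure.
        (\<forall>i\<in>S. prob_space (D i) \<and> sets (D i) = sets borel \<and> emeasure (D i) {0..1} = 1) \<longrightarrow>
        measure (bandit_space S D)
          {(u, X) \<in> space (bandit_space S D).
             good_run P S D eps
               (C * (\<Sum>i\<in>S. var_of (D i) / eps\<^sup>2 + 1 / eps) * (ln (1 / delta) + LL (1 / eps)))
               u X}
        \<ge> 1 - delta)"
\<comment> \<open>\<open>48 = 8 * 6\<close>: \<open>prob_success\<close> allows
  \<open>8 * 10 ^ 8 * L\<close>, and \<open>L \<le> 6 * l\<close>.\<close>
proof (rule exI[of _ "48 * 10 ^ 8"], intro conjI allI impI)
  fix S :: "nat set" and eps delta :: real
  assume *: "finite S \<and> S \<noteq> {} \<and> 0 < eps \<and> eps < 1 \<and> 0 < delta \<and> delta \<le> 1/2"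
  define l where "l = ln (1 / delta) + LL (1 / eps)"
  define L where "L = l + 5"
  have L: "1 \<le> L" "L \<le> 6 * l" and budget: "10 * (real (nat \<lceil>log 2 (1 / eps)\<rceil>) + 1) * exp (- L) \<le> delta"
    unfolding L_def l_def using failure_budget[of eps delta] * by auto
  interpret G: grouped_elimination S eps L using * L by unfold_locales auto
  let ?P = "staged_policy S (Suc G.R) G.demand G.out"
  show "\<exists>P::policy. \<forall>D::nat \<Rightarrow> real measure.
        (\<forall>i\<in>S. prob_space (D i) \<and> sets (D i) = sets borel \<and> emeasure (D i) {0..1} = 1) \<longrightarrow>
        measure (bandit_space S D)
          {(u, X) \<in> space (bandit_space S D).
             good_run P S D eps
               (48 * 10 ^ 8 * (\<Sum>i\<in>S. var_of (D i) / eps\<^sup>2 + 1 / eps) * (ln (1 / delta) + LL (1 / eps)))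
               u X}
        \<ge> 1 - delta"
  proof (intro exI[of _ ?P] allI impI)
    fix D0 :: "nat \<Rightarrow> real measure"
    assume D0: "\<forall>i\<in>S. prob_space (D0 i) \<and> sets (D0 i) = sets borel \<and> emeasure (D0 i) {0..1} = 1"
    \<comment> \<open>The locale \<open>arms\<close> wants a unit distribution for every index,
      whereas \<open>D0\<close> is constrained on \<open>S\<close> only; outside \<open>S\<close> a
      point mass at 0 is substituted.\<close>
    define D where "D i = (if i \<in> S then D0 i else return borel 0)" for i
    have "unit_distribution (D i)" for i
      using D0 by (intro unit_distribution_from_support) (auto simp: D_def prob_space_return)
    then interpret elimination_run S D eps L
      using * by (intro elimination_run.intro arms.intro G.grouped_elimination_axioms) auto
    define c where "c = (\<Sum>i\<in>S. var_of (D i) / eps\<^sup>2 + 1 / eps)"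
    define B where "B = 48 * 10 ^ 8 * c * l"
    have c0: "c = (\<Sum>i\<in>S. var_of (D0 i) / eps\<^sup>2 + 1 / eps)" by (simp add: c_def D_def)
    have "0 \<le> c" unfolding c_def using * by (intro sum_nonneg add_nonneg_nonneg divide_nonneg_nonneg arm.var_nonneg) auto
    have "8 * 10 ^ 8 * L * c \<le> 8 * 10 ^ 8 * (6 * l) * c"
      using L \<open>0 \<le> c\<close> by (intro mult_right_mono mult_left_mono) auto
    then have cB: "8 * 10 ^ 8 * L * (\<Sum>i\<in>S. var_of (D i) / eps\<^sup>2 + 1 / eps) \<le> B"
      unfolding c_def[symmetric] B_def by (simp add: algebra_simps)
    let ?ok = "\<lambda>X :: table. G.out X \<in> S \<and> \<bar>mean_of (D (G.out X)) - top\<bar> \<le> eps \<and> real (\<Sum>i\<in>S. G.demand (Suc G.R) X i) \<le> B"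
    have "(\<lambda>i. mean_of (D i)) ` S = (\<lambda>i. mean_of (D0 i)) ` S" by (simp add: D_def)
    then have good: "good_run ?P S D0 eps B u X \<longleftrightarrow> ?ok X" for u X
      unfolding G.good_run_staged_policy top_def by (auto simp: D_def)
    have "bandit_space S D0 = bandit_space S D"
      unfolding bandit_space_def by (intro arg_cong2[of _ _ _ _ pair_measure] PiM_cong refl) (simp add: D_def)
    then have "measure (bandit_space S D0) {(u, X) \<in> space (bandit_space S D0). good_run ?P S D0 eps B u X}
        = \<P>(X in T. ?ok X)"
      unfolding good
      by (simp only:) (rule measure_bandit_space[OF prob_space_T], use success_measurable[of B] in \<open>simp add: pred_def\<close>)
    also have "\<dots> \<ge> 1 - 10 * (real G.K + 1) * exp (- L)"
      by (rule prob_success[OF cB])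
    finally show "1 - delta \<le> measure (bandit_space S D0)
          {(u, X) \<in> space (bandit_space S D0).
             good_run ?P S D0 eps
               (48 * 10 ^ 8 * (\<Sum>i\<in>S. var_of (D0 i) / eps\<^sup>2 + 1 / eps) * (ln (1 / delta) + LL (1 / eps))) u X}"
      using budget by (simp add: G.K_def B_def c0 l_def)
  qed
qed simp

end
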